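(* Let $H$ be a Fréchet–Hilbert space, $u\colon\mathcal{S}\to H$ a continuous linear map and $k,n\in\mathbb{N}$. Then there exist $(2n+1)$-states $\phi_1,\phi_2$ on $\mathcal{S}$ such that for all $x\in\mathcal{S}$, \[\|ux\|_k\leqslant\sqrt{K}\,\|u\|_{n,k}\big(\phi_1(x^*x)+\phi_2(xx^* )\big)^{1/2}.\]
   Context: Let $\mathbb{N}=\{1,2,\dots\}$. Let $s$ be the space of complex sequences $\xi=(\xi_j)_{j\geqslant1}$ with $|\xi|_n:=(\sum_{j}|\xi_j|^2j^{2n})^{1/2}<\infty$ for all $n\in\mathbb{N}$, and let $s'$ be its dual, the space of sequences $\eta$ with $|\eta|_n':=(\sum_j|\eta_j|^2j^{-2n})^{1/2}<\infty$ for some $n$, with pairing $\langle\xi,\eta\rangle=\sum_j\xi_j\overline{\eta_j}$. The noncommutative Schwartz space $\mathcal{S}=L(s',s)$ is the Fréchet space of continuous linear operators $s'\to s$ with the topology of uniform convergence on bounded sets; it is a $*$-algebra with product $xy:=x\circ\iota\circ y$ ($\iota\colon s\hookrightarrow s'$ the inclusion) and involution given by $\langle x^*\xi,\eta\rangle=\langle\xi,x\eta\rangle$; $\mathcal{S}'$ is its dual. For $n\in\mathbb{N}$, $\|x\|_n:=\sup\{|x\xi|_n\colon \xi\in s',\ |\xi|_n'\leqslant1\}$, and $\|u\|_n^*:=\sup\{|u(x,y)|\colon\|x\|_n\leqslant1,\|y\|_n\leqslant1\}$ for bilinear $u$. For $x_1,\dots,x_m\in\mathcal{S}$, $\|(x_j)\|_k^{rc}:=\max\{\|\sum_jx_j^*x_j\|_k^{1/2},\|\sum_jx_jx_j^*\|_k^{1/2}\}$.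 A Fréchet–Hilbert space $H$ is a Fréchet space whose topology is given by a non-decreasing sequence of seminorms $\|\cdot\|_k$ induced by semi-inner products. For a linear map $T\colon\mathcal{S}\to H$, $\|T\|_{n,k}:=\sup\{\|Tx\|_k\colon\|x\|_n\leqslant1\}$. For $\xi\in s'$ with $|\xi|_n'\leqslant1$ let $\phi_\xi(x)=\langle x\xi,\xi\rangle$; an $n$-state on $\mathcal{S}$ is an element of the closed convex hull in $\mathcal{S}'$ of $\{\phi_\xi\colon |\xi|_n'\leqslant1\}$. For $n\in\mathbb{N}$, $K_n$ denotes the smallest constant such that $|\sum_{j=1}^mu(x_j,y_j)|\leqslant K_n\|u\|_n^*\|(x_j)\|_{2n+1}^{rc}\|(y_j)\|_{2n+1}^{rc}$ for all continuous bilinear forms $u$ on $\mathcal{S}\times\mathcal{S}$, all $m$ and all $x_j,y_j\in\mathcal{S}$; and $K:=\sup_nK_n$ (which satisfies $K\leqslant\pi^2/6$). *)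

theory Defs
  imports "HOL-Analysis.Analysis"
begin

text \<open>Sequences are indexed by nat starting at 0; the paper's index j corresponds to j+1.\<close>

type_synonym sq = "nat \<Rightarrow> complex"
type_synonym op = "sq \<Rightarrow> sq"

definition s_set :: "sq set" where
  "s_set = {\<xi>. \<forall>n::nat. summable (\<lambda>j. (cmod (\<xi> j))\<^sup>2 * real (Suc j) ^ (2*n))}"

definition snorm :: "nat \<Rightarrow> sq \<Rightarrow> real" where
  "snorm n \<xi> = sqrt (\<Sum>j. (cmod (\<xi> j))\<^sup>2 * real (Suc j) ^ (2*n))"

definition s'_summ :: "nat \<Rightarrow> sq \<Rightarrow> bool" where
  "s'_summ n \<eta> \<longleftrightarrow> summable (\<lambda>j. (cmod (\<eta> j))\<^sup>2 / real (Suc j) ^ (2*n))"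

definition s'_set :: "sq set" where
  "s'_set = {\<eta>. \<exists>n. s'_summ n \<eta>}"

definition s'norm :: "nat \<Rightarrow> sq \<Rightarrow> real" where
  "s'norm n \<eta> = sqrt (\<Sum>j. (cmod (\<eta> j))\<^sup>2 / real (Suc j) ^ (2*n))"

definition s'ball :: "nat \<Rightarrow> sq set" where
  "s'ball n = {\<eta>. s'_summ n \<eta> \<and> s'norm n \<eta> \<le> 1}"

definition pair :: "sq \<Rightarrow> sq \<Rightarrow> complex" where
  "pair \<xi> \<eta> = (\<Sum>j. \<xi> j * cnj (\<eta> j))"

text \<open>The noncommutative Schwartz space L(s',s): continuous linear maps s' \<rightarrow> s,
  represented as functions that vanish outside s' (canonical representative).
  Continuity of a linear map from the (LB)-space s' = ind lim of the weighted
  l2 steps into the Frechet space s.\<close>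
definition S_set :: "op set" where
  "S_set = {x.
     (\<forall>\<xi>. \<xi> \<notin> s'_set \<longrightarrow> x \<xi> = (\<lambda>j. 0)) \<and>
     (\<forall>\<xi>\<in>s'_set. x \<xi> \<in> s_set) \<and>
     (\<forall>\<xi>\<in>s'_set. \<forall>\<eta>\<in>s'_set. x (\<lambda>j. \<xi> j + \<eta> j) = (\<lambda>j. x \<xi> j + x \<eta> j)) \<and>
     (\<forall>\<xi>\<in>s'_set. \<forall>c::complex. x (\<lambda>j. c * \<xi> j) = (\<lambda>j. c * x \<xi> j)) \<and>
     (\<forall>m n. \<exists>C. \<forall>\<xi>. s'_summ m \<xi> \<longrightarrow> snorm n (x \<xi>) \<le> C * s'norm m \<xi>)}"

text \<open>product xy = x \<circ> \<iota> \<circ> y\<close>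
definition opmult :: "op \<Rightarrow> op \<Rightarrow> op" where
  "opmult x y = x \<circ> y"

definition adj :: "op \<Rightarrow> op" where
  "adj x = (\<lambda>\<xi>. if \<xi> \<in> s'_set
      then (SOME z. z \<in> s_set \<and> (\<forall>\<eta>\<in>s'_set. pair z \<eta> = pair \<xi> (x \<eta>)))
      else (\<lambda>j. 0))"

definition opnorm :: "nat \<Rightarrow> op \<Rightarrow> real" where
  "opnorm n x = Sup {snorm n (x \<xi>) | \<xi>. \<xi> \<in> s'ball n}"

definition opsum :: "nat \<Rightarrow> (nat \<Rightarrow> op) \<Rightarrow> op" where
  "opsum m xs = (\<lambda>\<xi> j. \<Sum>i<m. xs i \<xi> j)"

definition rcnorm :: "nat \<Rightarrow> nat \<Rightarrow> (nat \<Rightarrow> op) \<Rightarrow> real" where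
  "rcnorm k m xs = max (sqrt (opnorm k (opsum m (\<lambda>i. opmult (adj (xs i)) (xs i)))))
                       (sqrt (opnorm k (opsum m (\<lambda>i. opmult (xs i) (adj (xs i))))))"

definition S_dual :: "(op \<Rightarrow> complex) set" where
  "S_dual = {f.
     (\<forall>x\<in>S_set. \<forall>y\<in>S_set. f (\<lambda>\<xi> j. x \<xi> j + y \<xi> j) = f x + f y) \<and>
     (\<forall>x\<in>S_set. \<forall>c. f (\<lambda>\<xi> j. c * x \<xi> j) = c * f x) \<and>
     (\<exists>n C. \<forall>x\<in>S_set. cmod (f x) \<le> C * opnorm n x)}"

definition phi :: "sq \<Rightarrow> op \<Rightarrow> complex" where
  "phi \<xi> = (\<lambda>x. pair (x \<xi>) \<xi>)"

definition conv_states :: "nat \<Rightarrow> (op \<Rightarrow> complex) set" where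
  "conv_states n = {\<psi>. \<exists>m (c::nat \<Rightarrow> real) \<xi>s.
      (\<forall>i<m. c i \<ge> 0 \<and> \<xi>s i \<in> s'ball n) \<and> (\<Sum>i<m. c i) = 1 \<and>
      \<psi> = (\<lambda>x. \<Sum>i<m. complex_of_real (c i) * phi (\<xi>s i) x)}"

text \<open>n-state: element of the (weak-star) closed convex hull in S' of the phi_xi\<close>
definition nstate :: "nat \<Rightarrow> (op \<Rightarrow> complex) \<Rightarrow> bool" where
  "nstate n \<phi> \<longleftrightarrow> \<phi> \<in> S_dual \<and>
     (\<forall>F. finite F \<longrightarrow> F \<subseteq> S_set \<longrightarrow> (\<forall>\<epsilon>>0. \<exists>\<psi>\<in>conv_states n. \<forall>x\<in>F. cmod (\<phi> x - \<psi> x) < \<epsilon>))"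

definition cont_bilinear :: "(op \<Rightarrow> op \<Rightarrow> complex) \<Rightarrow> bool" where
  "cont_bilinear u \<longleftrightarrow>
     (\<forall>x\<in>S_set. \<forall>y\<in>S_set. \<forall>z\<in>S_set. u (\<lambda>\<xi> j. x \<xi> j + y \<xi> j) z = u x z + u y z
                                    \<and> u z (\<lambda>\<xi> j. x \<xi> j + y \<xi> j) = u z x + u z y) \<and>
     (\<forall>x\<in>S_set. \<forall>y\<in>S_set. \<forall>c. u (\<lambda>\<xi> j. c * x \<xi> j) y = c * u x y
                              \<and> u x (\<lambda>\<xi> j. c * y \<xi> j) = c * u x y) \<and>
     (\<exists>n C. \<forall>x\<in>S_set. \<forall>y\<in>S_set. cmod (u x y) \<le> C * opnorm n x * opnorm n y)"

definition bform_set :: "nat \<Rightarrow> (op \<Rightarrow> op \<Rightarrow> complex) \<Rightarrow> real set" where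
  "bform_set n u = {cmod (u x y) | x y. x \<in> S_set \<and> y \<in> S_set \<and> opnorm n x \<le> 1 \<and> opnorm n y \<le> 1}"

definition bnorm :: "nat \<Rightarrow> (op \<Rightarrow> op \<Rightarrow> complex) \<Rightarrow> real" where
  "bnorm n u = Sup (bform_set n u)"

text \<open>K_n: smallest admissible constant (forms with infinite ||u||*_n impose no constraint)\<close>
definition Kn :: "nat \<Rightarrow> real" where
  "Kn n = Inf {C. \<forall>u. cont_bilinear u \<longrightarrow> bdd_above (bform_set n u) \<longrightarrow>
       (\<forall>m xs ys. (\<forall>j<m. xs j \<in> S_set \<and> ys j \<in> S_set) \<longrightarrow>
          cmod (\<Sum>j<m. u (xs j) (ys j))
            \<le> C * bnorm n u * rcnorm (2*n+1) m xs * rcnorm (2*n+1) m ys)}"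

definition Kconst :: real where
  "Kconst = (SUP n\<in>{1..}. Kn n)"

definition hnorm :: "(nat \<Rightarrow> 'h \<Rightarrow> 'h \<Rightarrow> complex) \<Rightarrow> nat \<Rightarrow> 'h \<Rightarrow> real" where
  "hnorm ip k h = sqrt (Re (ip k h h))"

definition frechet_hilbert :: "(complex \<Rightarrow> 'h::ab_group_add \<Rightarrow> 'h) \<Rightarrow> (nat \<Rightarrow> 'h \<Rightarrow> 'h \<Rightarrow> complex) \<Rightarrow> bool" where
  "frechet_hilbert smul ip \<longleftrightarrow>
     (\<forall>a. smul 1 a = a) \<and> (\<forall>r t a. smul r (smul t a) = smul (r * t) a) \<and>
     (\<forall>r a b. smul r (a + b) = smul r a + smul r b) \<and>
     (\<forall>r t a. smul (r + t) a = smul r a + smul t a) \<and>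
     (\<forall>k a b c. ip k (a + b) c = ip k a c + ip k b c) \<and>
     (\<forall>k r a b. ip k (smul r a) b = r * ip k a b) \<and>
     (\<forall>k a b. ip k a b = cnj (ip k b a)) \<and>
     (\<forall>k a. Re (ip k a a) \<ge> 0) \<and>
     (\<forall>k h. hnorm ip k h \<le> hnorm ip (Suc k) h) \<and>
     (\<forall>h. (\<forall>k. hnorm ip k h = 0) \<longrightarrow> h = 0) \<and>
     (\<forall>f::nat \<Rightarrow> 'h. (\<forall>k. \<forall>\<epsilon>>0. \<exists>N. \<forall>i\<ge>N. \<forall>j\<ge>N. hnorm ip k (f i - f j) < \<epsilon>) \<longrightarrow>
        (\<exists>l. \<forall>k. (\<lambda>i. hnorm ip k (f i - l)) \<longlonglongrightarrow> 0))"

definition cont_lin_map :: "(complex \<Rightarrow> 'h::ab_group_add \<Rightarrow> 'h) \<Rightarrow> (nat \<Rightarrow> 'h \<Rightarrow> 'h \<Rightarrow> complex) \<Rightarrow> (op \<Rightarrow> 'h) \<Rightarrow> bool" where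
  "cont_lin_map smul ip u \<longleftrightarrow>
     (\<forall>x\<in>S_set. \<forall>y\<in>S_set. u (\<lambda>\<xi> j. x \<xi> j + y \<xi> j) = u x + u y) \<and>
     (\<forall>x\<in>S_set. \<forall>c. u (\<lambda>\<xi> j. c * x \<xi> j) = smul c (u x)) \<and>
     (\<forall>k. \<exists>n C. \<forall>x\<in>S_set. hnorm ip k (u x) \<le> C * opnorm n x)"

definition unorm_set :: "(nat \<Rightarrow> 'h \<Rightarrow> 'h \<Rightarrow> complex) \<Rightarrow> (op \<Rightarrow> 'h) \<Rightarrow> nat \<Rightarrow> nat \<Rightarrow> real set" where
  "unorm_set ip u n k = {hnorm ip k (u x) | x. x \<in> S_set \<and> opnorm n x \<le> 1}"

definition unorm :: "(nat \<Rightarrow> 'h \<Rightarrow> 'h \<Rightarrow> complex) \<Rightarrow> (op \<Rightarrow> 'h) \<Rightarrow> nat \<Rightarrow> nat \<Rightarrow> real" where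
  "unorm ip u n k = Sup (unorm_set ip u n k)"

end

theory Submission
  imports Defs
begin

text \<open>
  The form \<open>v(x, y) = \<langle>u x, u y\<^sup>*\<rangle>\<^sub>k\<close> is bilinear with \<open>\<parallel>v\<parallel>\<^sub>n\<^sup>* \<le> \<parallel>u\<parallel>\<^sub>n\<^sub>,\<^sub>k\<^sup>2\<close>, so the
  Grothendieck inequality applied to \<open>(x\<^sub>j)\<close> and \<open>(x\<^sub>j\<^sup>*)\<close> bounds \<open>\<Sum> \<parallel>u x\<^sub>j\<parallel>\<^sub>k\<^sup>2\<close> by
  \<open>K \<parallel>u\<parallel>\<^sup>2\<close> times the square of the row-column norm. On a positive operator the seminorm is the supremum of the
  vector states; a minimax argument followed by Tychonoff compactness turns the bound on finite families
  into a pointwise bound by two states.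
  Since \<open>K\<close> is an infimum, the inequality must hold for some constant at all: the squared
  Hilbert--Schmidt norms of \<open>D\<^sup>n x\<^sub>j D\<^sup>n\<close>, with \<open>D = diag(1, 2, \<dots>)\<close>, sum to at most \<open>\<Sum> 1/j\<^sup>2\<close> times the
  square of the row-column norm of order \<open>2n+1\<close>, uniformly in \<open>n\<close>.
\<close>

section \<open>Weighted sequence spaces\<close>

text \<open>The order 2n+1 comes from the matrix estimate. With indices from 1, the entry in row k
  and column l carries the weight \<open>k^(2n) l^(2n)\<close>, at most the mean of
  \<open>k^(4n)\<close> and \<open>l^(4n)\<close>. Evaluating the two Gram operators at a coordinate
  vector gives row and column sums of size \<open>k^(-2(2n+1))\<close>; the surplus
  \<open>k^(-2)\<close> makes the series converge, uniformly in n. Two states are used because the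
  row-column norm is a maximum over two Gram operators, and a maximum of nonnegative numbers is at
  most their sum. Finite convex combinations of vector states do not form an evidently closed set.
  The separation argument therefore runs on finite families with an error e, and compactness is
  invoked only for the closure, where the error disappears. Infima and suprema of reals are
  arbitrary values when the set is empty or unbounded, so \<open>Kn\<close>, \<open>Kconst\<close>
  and \<open>unorm\<close> have to be shown to be genuine bounds wherever they are used. The sign of
  \<open>Kconst\<close> is not known beforehand either; the degenerate cases are met by the zero
  functional, which is a state because the balls contain 0.\<close>

definition l2 :: "sq \<Rightarrow> bool" where
  "l2 f \<longleftrightarrow> summable (\<lambda>j. (cmod (f j))\<^sup>2)"

definition l2_norm :: "sq \<Rightarrow> real" where
  "l2_norm f = sqrt (\<Sum>j. (cmod (f j))\<^sup>2)"

lemma l2_norm_nonneg: "l2 f \<Longrightarrow> 0 \<le> l2_norm f"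
  unfolding l2_def l2_norm_def by (simp add: suminf_nonneg)

lemma l2_norm_power2: "l2 f \<Longrightarrow> (l2_norm f)\<^sup>2 = (\<Sum>j. (cmod (f j))\<^sup>2)"
  unfolding l2_def l2_norm_def by (simp add: suminf_nonneg)

lemma L2_set_le_l2_norm: "l2 f \<Longrightarrow> L2_set (\<lambda>j. cmod (f j)) {..<N} \<le> l2_norm f"
  unfolding l2_def l2_norm_def L2_set_def
  by (intro real_sqrt_le_mono sum_le_suminf) auto

text \<open>Carries the finite inequalities for \<open>L2_set\<close> over to series: one bound on
  all partial sums yields both convergence and the norm estimate.\<close>

lemma l2_boundedI:
  assumes "\<And>N. L2_set (\<lambda>j. cmod (f j)) {..<N} \<le> M"
  shows "l2 f" "l2_norm f \<le> M"
proof -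
  have M: "0 \<le> M" using assms[of 0] by simp
  have le: "(\<Sum>j<N. (cmod (f j))\<^sup>2) \<le> M\<^sup>2" for N
    using assms[of N] unfolding L2_set_def by (simp add: sqrt_le_D)
  show "l2 f" unfolding l2_def
    by (rule summableI_nonneg_bounded[OF _ le]) simp
  then show "l2_norm f \<le> M" unfolding l2_def l2_norm_def
    using suminf_le_const[OF _ le] M by (intro real_le_lsqrt) auto
qed

lemma l2_prod_sum_bound:
  assumes "l2 f" "l2 g"
  shows "(\<Sum>j<N. cmod (f j * cnj (g j))) \<le> l2_norm f * l2_norm g"
proof -
  have "(\<Sum>j<N. cmod (f j * cnj (g j)))
      \<le> L2_set (\<lambda>j. cmod (f j)) {..<N} * L2_set (\<lambda>j. cmod (g j)) {..<N}"
    using L2_set_mult_ineq[of "\<lambda>j. cmod (f j)" "\<lambda>j. cmod (g j)" "{..<N}"]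
    by (simp add: norm_mult)
  also have "\<dots> \<le> l2_norm f * l2_norm g"
    by (intro mult_mono L2_set_le_l2_norm l2_norm_nonneg L2_set_nonneg assms)
  finally show ?thesis .
qed

lemma l2_prod_summable:
  assumes "l2 f" "l2 g"
  shows "summable (\<lambda>j. cmod (f j * cnj (g j)))"
  by (rule summableI_nonneg_bounded[OF _ l2_prod_sum_bound[OF assms]]) simp

lemma l2_Cauchy_Schwarz:
  assumes "l2 f" "l2 g"
  shows "cmod (\<Sum>j. f j * cnj (g j)) \<le> l2_norm f * l2_norm g"
proof -
  have "cmod (\<Sum>j. f j * cnj (g j)) \<le> (\<Sum>j. cmod (f j * cnj (g j)))"
    by (rule summable_norm[OF l2_prod_summable[OF assms]])
  also have "\<dots> \<le> l2_norm f * l2_norm g"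
    by (rule suminf_le_const[OF l2_prod_summable[OF assms] l2_prod_sum_bound[OF assms]])
  finally show ?thesis .
qed

lemma l2_add:
  assumes "l2 f" "l2 g"
  shows "l2 (\<lambda>j. f j + g j)" "l2_norm (\<lambda>j. f j + g j) \<le> l2_norm f + l2_norm g"
proof -
  have "L2_set (\<lambda>j. cmod (f j + g j)) {..<N} \<le> l2_norm f + l2_norm g" for N
  proof -
    have "L2_set (\<lambda>j. cmod (f j + g j)) {..<N}
        \<le> L2_set (\<lambda>j. cmod (f j) + cmod (g j)) {..<N}"
      by (rule L2_set_mono) (auto simp: norm_triangle_ineq)
    also have "\<dots> \<le> L2_set (\<lambda>j. cmod (f j)) {..<N} + L2_set (\<lambda>j. cmod (g j)) {..<N}"
      by (rule L2_set_triangle_ineq)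
    finally show ?thesis
      using L2_set_le_l2_norm[OF assms(1), of N] L2_set_le_l2_norm[OF assms(2), of N] by linarith
  qed
  then show "l2 (\<lambda>j. f j + g j)" "l2_norm (\<lambda>j. f j + g j) \<le> l2_norm f + l2_norm g"
    by (rule l2_boundedI)+
qed

lemma l2_scale:
  assumes "l2 f"
  shows "l2 (\<lambda>j. c * f j)" "l2_norm (\<lambda>j. c * f j) = cmod c * l2_norm f"
proof -
  show "l2 (\<lambda>j. c * f j)"
    using assms unfolding l2_def norm_mult power_mult_distrib by (rule summable_mult)
  show "l2_norm (\<lambda>j. c * f j) = cmod c * l2_norm f"
    using assms unfolding l2_def l2_norm_def norm_mult power_mult_distrib
    by (simp add: suminf_mult real_sqrt_mult)
qed

lemma weight_power2:
  "(cmod (z * of_nat (Suc j) ^ n))\<^sup>2 = (cmod z)\<^sup>2 * real (Suc j) ^ (2*n)"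
  "(cmod (z / of_nat (Suc j) ^ n))\<^sup>2 = (cmod z)\<^sup>2 / real (Suc j) ^ (2*n)"
  by (simp_all add: norm_mult norm_divide norm_power power_mult_distrib power_divide
      power_even_eq del: of_nat_Suc)

text \<open>The weights are absorbed into the sequence, so Minkowski and Cauchy--Schwarz for all the
  norms on s and on the steps of s' reduce to the unweighted case.\<close>

lemma s_set_iff: "\<xi> \<in> s_set \<longleftrightarrow> (\<forall>n. l2 (\<lambda>j. \<xi> j * of_nat (Suc j) ^ n))"
  unfolding s_set_def l2_def weight_power2 by simp

lemma snorm_eq: "snorm n \<xi> = l2_norm (\<lambda>j. \<xi> j * of_nat (Suc j) ^ n)"
  unfolding snorm_def l2_norm_def weight_power2 by simp

lemma s'_summ_iff: "s'_summ n \<eta> \<longleftrightarrow> l2 (\<lambda>j. \<eta> j / of_nat (Suc j) ^ n)"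
  unfolding s'_summ_def l2_def weight_power2 by simp

lemma s'norm_eq: "s'norm n \<eta> = l2_norm (\<lambda>j. \<eta> j / of_nat (Suc j) ^ n)"
  unfolding s'norm_def l2_norm_def weight_power2 by simp

lemma snorm_nonneg: "\<xi> \<in> s_set \<Longrightarrow> 0 \<le> snorm n \<xi>"
  unfolding s_set_iff snorm_eq by (simp add: l2_norm_nonneg)

lemma s'norm_nonneg: "s'_summ n \<eta> \<Longrightarrow> 0 \<le> s'norm n \<eta>"
  unfolding s'_summ_iff s'norm_eq by (simp add: l2_norm_nonneg)

lemma snorm_power2:
  "\<xi> \<in> s_set \<Longrightarrow> (\<lambda>j. (cmod (\<xi> j))\<^sup>2 * real (Suc j) ^ (2*n)) sums (snorm n \<xi>)\<^sup>2"
  using l2_norm_power2[of "\<lambda>j. \<xi> j * of_nat (Suc j) ^ n"]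
  unfolding s_set_iff snorm_eq l2_def weight_power2 by (auto simp: sums_iff)

lemma s'norm_power2:
  "s'_summ n \<eta> \<Longrightarrow> (\<lambda>j. (cmod (\<eta> j))\<^sup>2 / real (Suc j) ^ (2*n)) sums (s'norm n \<eta>)\<^sup>2"
  using l2_norm_power2[of "\<lambda>j. \<eta> j / of_nat (Suc j) ^ n"]
  unfolding s'_summ_iff s'norm_eq l2_def weight_power2 by (auto simp: sums_iff)

lemma s_set_add: "\<xi> \<in> s_set \<Longrightarrow> \<eta> \<in> s_set \<Longrightarrow> (\<lambda>j. \<xi> j + \<eta> j) \<in> s_set"
  unfolding s_set_iff distrib_right by (auto intro: l2_add)

lemma snorm_add:
  "\<xi> \<in> s_set \<Longrightarrow> \<eta> \<in> s_set \<Longrightarrow> snorm n (\<lambda>j. \<xi> j + \<eta> j) \<le> snorm n \<xi> + snorm n \<eta>"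
  unfolding s_set_iff snorm_eq distrib_right by (auto intro: l2_add)

lemma s_set_scale: "\<xi> \<in> s_set \<Longrightarrow> (\<lambda>j. c * \<xi> j) \<in> s_set"
  unfolding s_set_iff mult.assoc by (auto intro: l2_scale)

lemma snorm_scale: "\<xi> \<in> s_set \<Longrightarrow> snorm n (\<lambda>j. c * \<xi> j) = cmod c * snorm n \<xi>"
  unfolding s_set_iff snorm_eq mult.assoc by (auto intro: l2_scale)

lemma s_set_zero: "(\<lambda>j. 0) \<in> s_set" and snorm_zero: "snorm n (\<lambda>j. 0) = 0"
  by (simp_all add: s_set_def snorm_def)

lemma s'_summ_zero: "s'_summ n (\<lambda>j. 0)" and s'norm_zero: "s'norm n (\<lambda>j. 0) = 0"
  by (simp_all add: s'_summ_def s'norm_def)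

lemma zero_in_s'ball: "(\<lambda>j. 0) \<in> s'ball n"
  by (simp add: s'ball_def s'_summ_zero s'norm_zero)

lemma zero_in_s'_set: "(\<lambda>j. 0) \<in> s'_set"
  using s'_summ_zero by (auto simp: s'_set_def)

lemma s'_summ_scale: "s'_summ n \<xi> \<Longrightarrow> s'_summ n (\<lambda>j. c * \<xi> j)"
  unfolding s'_summ_iff times_divide_eq_right[symmetric] by (rule l2_scale)

lemma s'norm_scale: "s'_summ n \<xi> \<Longrightarrow> s'norm n (\<lambda>j. c * \<xi> j) = cmod c * s'norm n \<xi>"
  unfolding s'_summ_iff s'norm_eq times_divide_eq_right[symmetric] by (rule l2_scale)

lemma s'_summ_add: "s'_summ n \<xi> \<Longrightarrow> s'_summ n \<eta> \<Longrightarrow> s'_summ n (\<lambda>j. \<xi> j + \<eta> j)"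
  unfolding s'_summ_iff add_divide_distrib by (auto intro: l2_add)

lemma s'_summ_mono: "s'_summ m \<xi> \<Longrightarrow> m \<le> n \<Longrightarrow> s'_summ n \<xi>"
  unfolding s'_summ_def
  by (erule summable_comparison_test[rotated])
     (auto intro!: exI[of _ 0] divide_left_mono power_increasing)

lemma s'_set_add: "\<xi> \<in> s'_set \<Longrightarrow> \<eta> \<in> s'_set \<Longrightarrow> (\<lambda>j. \<xi> j + \<eta> j) \<in> s'_set"
proof -
  assume "\<xi> \<in> s'_set" "\<eta> \<in> s'_set"
  then obtain m n where "s'_summ m \<xi>" "s'_summ n \<eta>" by (auto simp: s'_set_def)
  then have "s'_summ (max m n) (\<lambda>j. \<xi> j + \<eta> j)"
    by (intro s'_summ_add; auto intro: s'_summ_mono)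
  then show ?thesis by (auto simp: s'_set_def)
qed

lemma s'_set_scale: "\<xi> \<in> s'_set \<Longrightarrow> (\<lambda>j. c * \<xi> j) \<in> s'_set"
  using s'_summ_scale by (auto simp: s'_set_def)

lemma s'_setI: "s'_summ n \<xi> \<Longrightarrow> \<xi> \<in> s'_set"
  by (auto simp: s'_set_def)

lemma s'ball_in_s'_set: "\<xi> \<in> s'ball n \<Longrightarrow> \<xi> \<in> s'_set"
  by (auto simp: s'_set_def s'ball_def)

text \<open>The inclusion of s into s' passes through the step of order 0, where both norms are the
  l2 norm. Composition of operators is estimated through this step.\<close>

lemma s'_summ_of_s: "\<xi> \<in> s_set \<Longrightarrow> s'_summ 0 \<xi>"
  unfolding s_set_def s'_summ_def by (auto dest: spec[of _ 0])

lemma s'norm_0: "s'norm 0 \<xi> = snorm 0 \<xi>"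
  by (simp add: s'norm_def snorm_def)

lemma s_set_subset: "\<xi> \<in> s_set \<Longrightarrow> \<xi> \<in> s'_set"
  by (rule s'_setI[OF s'_summ_of_s])

lemma weight_cancel: "z * of_nat (Suc j) ^ n * cnj (w / of_nat (Suc j) ^ n) = z * cnj w"
  by (simp del: of_nat_Suc)

lemma pair_summable:
  assumes "z \<in> s_set" "\<eta> \<in> s'_set"
  shows "summable (\<lambda>j. z j * cnj (\<eta> j))"
proof -
  obtain m where "l2 (\<lambda>j. z j * of_nat (Suc j) ^ m)" "l2 (\<lambda>j. \<eta> j / of_nat (Suc j) ^ m)"
    using assms by (auto simp: s_set_iff s'_set_def s'_summ_iff)
  from l2_prod_summable[OF this] show ?thesis
    unfolding weight_cancel by (rule summable_norm_cancel)
qed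

lemma pair_bound:
  assumes "z \<in> s_set" "s'_summ m \<eta>"
  shows "cmod (pair z \<eta>) \<le> snorm m z * s'norm m \<eta>"
proof -
  have "l2 (\<lambda>j. z j * of_nat (Suc j) ^ m)" "l2 (\<lambda>j. \<eta> j / of_nat (Suc j) ^ m)"
    using assms by (auto simp: s_set_iff s'_summ_iff)
  from l2_Cauchy_Schwarz[OF this] show ?thesis
    unfolding weight_cancel snorm_eq s'norm_eq pair_def .
qed

lemma pair_commute: "z \<in> s_set \<Longrightarrow> \<eta> \<in> s'_set \<Longrightarrow> pair \<eta> z = cnj (pair z \<eta>)"
proof -
  assume "z \<in> s_set" "\<eta> \<in> s'_set"
  then have "(\<lambda>j. z j * cnj (\<eta> j)) sums pair z \<eta>"
    unfolding pair_def by (intro summable_sums pair_summable)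
  then have "(\<lambda>j. \<eta> j * cnj (z j)) sums cnj (pair z \<eta>)"
    by (subst (asm) sums_cnj[symmetric]) (simp add: mult.commute)
  then show ?thesis unfolding pair_def by (simp add: sums_iff)
qed

lemma pair_add_left:
  "z \<in> s_set \<Longrightarrow> w \<in> s_set \<Longrightarrow> \<eta> \<in> s'_set \<Longrightarrow> pair (\<lambda>j. z j + w j) \<eta> = pair z \<eta> + pair w \<eta>"
  unfolding pair_def distrib_right by (intro suminf_add[symmetric] pair_summable)

lemma pair_scale_left:
  "z \<in> s_set \<Longrightarrow> \<eta> \<in> s'_set \<Longrightarrow> pair (\<lambda>j. c * z j) \<eta> = c * pair z \<eta>"
  unfolding pair_def mult.assoc by (intro suminf_mult pair_summable)

lemma pair_add_right:
  assumes "z \<in> s_set" "\<eta> \<in> s'_set" "\<zeta> \<in> s'_set"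
  shows "pair z (\<lambda>j. \<eta> j + \<zeta> j) = pair z \<eta> + pair z \<zeta>"
  unfolding pair_def complex_cnj_add distrib_left
  using assms by (intro suminf_add[symmetric] pair_summable)

lemma pair_scale_right:
  assumes "z \<in> s_set" "\<eta> \<in> s'_set"
  shows "pair z (\<lambda>j. c * \<eta> j) = cnj c * pair z \<eta>"
  unfolding pair_def complex_cnj_mult mult.left_commute[of _ "cnj c"]
  using assms by (intro suminf_mult pair_summable)

lemma pair_self: "z \<in> s_set \<Longrightarrow> pair z z = complex_of_real ((snorm 0 z)\<^sup>2)"
proof -
  assume "z \<in> s_set"
  from sums_of_real[OF snorm_power2[OF this, of 0], where 'a = complex]
  have "(\<lambda>j. complex_of_real ((cmod (z j))\<^sup>2)) sums complex_of_real ((snorm 0 z)\<^sup>2)"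
    by simp
  then show ?thesis unfolding pair_def complex_norm_square by (simp add: sums_iff)
qed

section \<open>Coordinate vectors and duality of the weighted norms\<close>

definition unit_sq :: "nat \<Rightarrow> sq" where
  "unit_sq k = (\<lambda>j. if j = k then 1 else 0)"

lemma unit_sq_in_s_set: "unit_sq k \<in> s_set"
  unfolding s_set_def
proof (intro CollectI allI)
  fix n show "summable (\<lambda>j. (cmod (unit_sq k j))\<^sup>2 * real (Suc j) ^ (2*n))"
    by (rule summable_finite[of "{k}"]) (auto simp: unit_sq_def)
qed

lemma unit_sq_in_s'_set: "unit_sq k \<in> s'_set"
  by (rule s_set_subset[OF unit_sq_in_s_set])

lemma pair_unit_sq: "pair z (unit_sq k) = z k"
proof -
  have "(\<lambda>j. z j * cnj (unit_sq k j)) = (\<lambda>j. if j = k then z j else 0)"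
    by (auto simp: unit_sq_def)
  then show ?thesis unfolding pair_def using sums_single[of k z] by (simp add: sums_iff)
qed

lemma s'_summ_unit_sq: "s'_summ p (unit_sq k)"
  and s'norm_unit_sq_power2: "(s'norm p (unit_sq k))\<^sup>2 = 1 / real (Suc k) ^ (2*p)"
proof -
  show *: "s'_summ p (unit_sq k)"
    by (rule s'_summ_mono[OF s'_summ_of_s[OF unit_sq_in_s_set]]) simp
  have "(\<lambda>j. (cmod (unit_sq k j))\<^sup>2 / real (Suc j) ^ (2*p))
     = (\<lambda>j. if j = k then 1 / real (Suc j) ^ (2*p) else 0)"
    by (auto simp: unit_sq_def)
  with s'norm_power2[OF *] sums_single[of k "\<lambda>j. 1 / real (Suc j) ^ (2*p)"]
  show "(s'norm p (unit_sq k))\<^sup>2 = 1 / real (Suc k) ^ (2*p)"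
    by (metis sums_unique2)
qed

text \<open>The norms of order n on s and s' are dual under \<open>pair\<close>. Equality in
  Cauchy--Schwarz is reached at z multiplied by the squared weight and then normalised, which is the
  vector \<open>\<eta>\<close> below.\<close>

lemma snorm_le_dual:
  assumes z: "z \<in> s_set" and M: "\<And>\<eta>. \<eta> \<in> s'ball n \<Longrightarrow> cmod (pair z \<eta>) \<le> M"
  shows "snorm n z \<le> M"
proof (cases "snorm n z = 0")
  case True
  then show ?thesis using M[OF zero_in_s'ball] norm_ge_zero order_trans by metis
next
  case False
  define s where "s = snorm n z"
  have s: "s > 0" using False snorm_nonneg[OF z, of n] by (simp add: s_def)
  define \<zeta> where "\<zeta> = (\<lambda>j. z j * of_nat (Suc j) ^ (2*n))"
  have eq: "\<zeta> j / of_nat (Suc j) ^ n = z j * of_nat (Suc j) ^ n" for j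
    by (simp add: \<zeta>_def field_simps power_mult power2_eq_square mult_2 power_add del: of_nat_Suc)
  have summ: "s'_summ n \<zeta>" and norm: "s'norm n \<zeta> = s"
    using z unfolding s'_summ_iff s'norm_eq eq s_def snorm_eq s_set_iff by auto
  have entry: "complex_of_real ((cmod (z j))\<^sup>2 * real (Suc j) ^ (2*n)) = z j * cnj (\<zeta> j)" for j
    unfolding \<zeta>_def of_real_mult complex_norm_square by (simp add: mult_ac)
  have "(\<lambda>j. z j * cnj (\<zeta> j)) sums complex_of_real (s\<^sup>2)"
    using sums_of_real[OF snorm_power2[OF z, of n], where 'a = complex] unfolding s_def entry .
  then have pz: "pair z \<zeta> = complex_of_real (s\<^sup>2)" unfolding pair_def by (simp add: sums_iff)
  define \<eta> where "\<eta> = (\<lambda>j. complex_of_real (1/s) * \<zeta> j)"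
  have "\<eta> \<in> s'ball n"
    using s'_summ_scale[OF summ, of "complex_of_real (1/s)"]
      s'norm_scale[OF summ, of "complex_of_real (1/s)"] s norm
    by (simp add: s'ball_def \<eta>_def norm_divide)
  moreover have "pair z \<eta> = complex_of_real s"
    unfolding \<eta>_def pair_scale_right[OF z s'_setI[OF summ]] pz
    using s by (simp add: power2_eq_square)
  ultimately show ?thesis using M[of \<eta>] s by (simp add: s_def)
qed

section \<open>The adjoint and the seminorms\<close>

text \<open>Every continuous antilinear functional on s' is given by an element of s; this is what
  makes adjoints exist. Continuity on the step of order p forces decay of order p on the
  coefficients, so all steps together place them in s.\<close>

lemma s_Riesz:
  assumes add: "\<And>\<xi> \<eta>. \<xi> \<in> s'_set \<Longrightarrow> \<eta> \<in> s'_set \<Longrightarrow> L (\<lambda>j. \<xi> j + \<eta> j) = L \<xi> + L \<eta>"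
    and scale: "\<And>\<xi> c. \<xi> \<in> s'_set \<Longrightarrow> L (\<lambda>j. c * \<xi> j) = cnj c * L \<xi>"
    and bound: "\<And>p. \<exists>C. \<forall>\<xi>. s'_summ p \<xi> \<longrightarrow> cmod (L \<xi>) \<le> C * s'norm p \<xi>"
  shows "\<exists>z\<in>s_set. \<forall>\<eta>\<in>s'_set. pair z \<eta> = L \<eta>"
proof -
  define z where "z k = L (unit_sq k)" for k
  define tr where "tr N \<eta> = (\<lambda>j. if j < N then \<eta> j else 0)" for N :: nat and \<eta> :: sq
  have tr_summ: "s'_summ p (tr N \<eta>)" for p N \<eta>
    unfolding s'_summ_def tr_def by (rule summable_finite[of "{..<N}"]) auto
  have tr_norm: "(s'norm p (tr N \<eta>))\<^sup>2 = (\<Sum>j<N. (cmod (\<eta> j))\<^sup>2 / real (Suc j) ^ (2*p))" for p N \<eta>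
  proof -
    have "(\<lambda>j. (cmod (tr N \<eta> j))\<^sup>2 / real (Suc j) ^ (2*p)) sums
        (\<Sum>j<N. (cmod (tr N \<eta> j))\<^sup>2 / real (Suc j) ^ (2*p))"
      by (rule sums_finite) (auto simp: tr_def)
    also have "(\<Sum>j<N. (cmod (tr N \<eta> j))\<^sup>2 / real (Suc j) ^ (2*p))
       = (\<Sum>j<N. (cmod (\<eta> j))\<^sup>2 / real (Suc j) ^ (2*p))"
      by (rule sum.cong) (auto simp: tr_def)
    finally show ?thesis using s'norm_power2[OF tr_summ] sums_unique2 by blast
  qed
  have L_tr: "L (tr N \<eta>) = (\<Sum>j<N. z j * cnj (\<eta> j))" for N \<eta>
  proof (induction N)
    case 0
    \<comment> \<open>The zero sequence is written as 0 times itself, so that antilinearity makes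
      \<open>L\<close> vanish there.\<close>
    have "L (\<lambda>j. 0 * 0) = cnj 0 * L (\<lambda>j. 0)" by (rule scale[OF zero_in_s'_set])
    then show ?case by (simp add: tr_def)
  next
    case (Suc N)
    have "tr (Suc N) \<eta> = (\<lambda>j. tr N \<eta> j + (\<lambda>j. \<eta> N * unit_sq N j) j)"
      by (auto simp: tr_def unit_sq_def less_Suc_eq)
    then have "L (tr (Suc N) \<eta>) = L (tr N \<eta>) + L (\<lambda>j. \<eta> N * unit_sq N j)"
      by (simp only:) (intro add s'_set_scale unit_sq_in_s'_set s'_setI[OF tr_summ])
    then show ?case
      using Suc scale[OF unit_sq_in_s'_set] by (simp add: z_def)
  qed
  have z: "z \<in> s_set"
    unfolding s_set_def
  proof (intro CollectI allI)
    fix n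
    obtain C where C: "\<And>\<xi>. s'_summ n \<xi> \<Longrightarrow> cmod (L \<xi>) \<le> C * s'norm n \<xi>"
      using bound[of n] by blast
    \<comment> \<open>On the truncations of this sequence \<open>L\<close> takes the value
      \<open>Q N\<close>, which is also the square of their dual norm. Continuity thus gives
      \<open>Q N \<le> C * sqrt (Q N)\<close>, a bound independent of N.\<close>
    define \<eta> where "\<eta> j = z j * of_nat (Suc j) ^ (2*n)" for j
    define Q where "Q N = (\<Sum>j<N. (cmod (z j))\<^sup>2 * real (Suc j) ^ (2*n))" for N
    have Q0: "Q N \<ge> 0" for N unfolding Q_def by (intro sum_nonneg) auto
    have "(s'norm n (tr N \<eta>))\<^sup>2 = Q N" for N
      unfolding tr_norm Q_def \<eta>_def
      by (intro sum.cong refl) (simp add: norm_mult norm_power power_mult_distrib power2_eq_square del: of_nat_Suc)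
    then have norm: "s'norm n (tr N \<eta>) = sqrt (Q N)" for N
      using s'norm_nonneg[OF tr_summ] by (metis real_sqrt_unique)
    have entry: "z j * cnj (\<eta> j) = complex_of_real ((cmod (z j))\<^sup>2 * real (Suc j) ^ (2*n))" for j
      unfolding \<eta>_def of_real_mult complex_norm_square by (simp add: mult_ac)
    have L_Q: "L (tr N \<eta>) = complex_of_real (Q N)" for N
      unfolding L_tr Q_def entry by (simp only: of_real_sum)
    have Q_le: "Q N \<le> C * sqrt (Q N)" for N
      using C[OF tr_summ, of N \<eta>] Q0[of N] unfolding norm L_Q by simp
    have "sqrt (Q N) \<le> C" if "Q N \<noteq> 0" for N
    proof (rule mult_right_le_imp_le)
      show "sqrt (Q N) * sqrt (Q N) \<le> C * sqrt (Q N)" using Q_le[of N] Q0[of N] by simp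
      show "0 < sqrt (Q N)" using that Q0[of N] by simp
    qed
    then have "sqrt (Q N) \<le> max C 0" for N
      by (cases "Q N = 0") (auto simp: le_max_iff_disj)
    then have "Q N \<le> (max C 0)\<^sup>2" for N by (rule sqrt_le_D)
    then show "summable (\<lambda>j. (cmod (z j))\<^sup>2 * real (Suc j) ^ (2*n))"
      unfolding Q_def by (intro summableI_nonneg_bounded) auto
  qed
  moreover have "pair z \<eta> = L \<eta>" if \<eta>: "\<eta> \<in> s'_set" for \<eta>
  proof -
    obtain p where p: "s'_summ p \<eta>" using \<eta> by (auto simp: s'_set_def)
    obtain C where C: "\<And>\<xi>. s'_summ p \<xi> \<Longrightarrow> cmod (L \<xi>) \<le> C * s'norm p \<xi>"
      using bound[of p] by blast
    define g where "g j = (cmod (\<eta> j))\<^sup>2 / real (Suc j) ^ (2*p)" for j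
    have g: "g sums (s'norm p \<eta>)\<^sup>2" unfolding g_def by (rule s'norm_power2[OF p])
    \<comment> \<open>The truncations converge to \<open>\<eta>\<close> in the norm of the one step
      p that contains it, so continuity of \<open>L\<close> on that step identifies the
      limit.\<close>
    define tail where "tail N = (\<lambda>j. \<eta> j + (-1) * tr N \<eta> j)" for N
    have tail_summ: "s'_summ p (tail N)" for N
      unfolding tail_def by (intro s'_summ_add p s'_summ_scale tr_summ)
    have "(\<lambda>j. g j - (if j < N then g j else 0)) sums ((s'norm p \<eta>)\<^sup>2 - (\<Sum>j<N. g j))" for N
      using sums_If_finite_set[of "{..<N}" g] by (intro sums_diff g) simp
    moreover have "(\<lambda>j. g j - (if j < N then g j else 0))
        = (\<lambda>j. (cmod (tail N j))\<^sup>2 / real (Suc j) ^ (2*p))" for N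
      by (auto simp: tail_def g_def tr_def)
    ultimately have "(s'norm p (tail N))\<^sup>2 = (s'norm p \<eta>)\<^sup>2 - (\<Sum>j<N. g j)" for N
      using s'norm_power2[OF tail_summ, of N] sums_unique2 by metis
    then have tail_norm: "s'norm p (tail N) = sqrt ((s'norm p \<eta>)\<^sup>2 - (\<Sum>j<N. g j))" for N
      using s'norm_nonneg[OF tail_summ] by (metis real_sqrt_unique)
    have "(\<lambda>N. C * sqrt ((s'norm p \<eta>)\<^sup>2 - (\<Sum>j<N. g j)))
        \<longlonglongrightarrow> C * sqrt ((s'norm p \<eta>)\<^sup>2 - (s'norm p \<eta>)\<^sup>2)"
      using g unfolding sums_def by (intro tendsto_intros)
    then have *: "(\<lambda>N. C * sqrt ((s'norm p \<eta>)\<^sup>2 - (\<Sum>j<N. g j))) \<longlonglongrightarrow> 0" by simp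
    have "(\<lambda>N. L (tail N)) \<longlonglongrightarrow> 0"
    proof (rule Lim_null_comparison[OF always_eventually *], intro allI)
      show "cmod (L (tail N)) \<le> C * sqrt ((s'norm p \<eta>)\<^sup>2 - (\<Sum>j<N. g j))" for N
        using C[OF tail_summ, of N] unfolding tail_norm .
    qed
    moreover have "L (tail N) = L \<eta> - (\<Sum>j<N. z j * cnj (\<eta> j))" for N
    proof -
      note t = s'_setI[OF tr_summ[of 0 N \<eta>]]
      have "L (tail N) = L \<eta> + L (\<lambda>j. (-1) * tr N \<eta> j)"
        unfolding tail_def by (rule add[OF \<eta> s'_set_scale[OF t]])
      also have "L (\<lambda>j. (-1) * tr N \<eta> j) = cnj (-1) * L (tr N \<eta>)" by (rule scale[OF t])
      finally show ?thesis by (simp add: L_tr)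
    qed
    ultimately have "(\<lambda>N. L \<eta> - (\<Sum>j<N. z j * cnj (\<eta> j))) \<longlonglongrightarrow> 0" by simp
    from tendsto_diff[OF tendsto_const[of "L \<eta>"] this]
    have "(\<lambda>N. \<Sum>j<N. z j * cnj (\<eta> j)) \<longlonglongrightarrow> L \<eta>" by simp
    then show ?thesis unfolding pair_def sums_def[symmetric] by (simp add: sums_iff)
  qed
  ultimately show ?thesis by blast
qed

section \<open>The operators from s' to s\<close>

lemma S_setD:
  assumes "x \<in> S_set"
  shows "\<xi> \<notin> s'_set \<Longrightarrow> x \<xi> = (\<lambda>j. 0)"
    and "\<xi> \<in> s'_set \<Longrightarrow> x \<xi> \<in> s_set"
    and "\<xi> \<in> s'_set \<Longrightarrow> \<eta> \<in> s'_set \<Longrightarrow> x (\<lambda>j. \<xi> j + \<eta> j) = (\<lambda>j. x \<xi> j + x \<eta> j)"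
    and "\<xi> \<in> s'_set \<Longrightarrow> x (\<lambda>j. c * \<xi> j) = (\<lambda>j. c * x \<xi> j)"
  using assms unfolding S_set_def by auto

lemma S_set_in_s: "x \<in> S_set \<Longrightarrow> x \<xi> \<in> s_set"
  using S_setD(1)[of x \<xi>] S_setD(2)[of x \<xi>] s_set_zero by (cases "\<xi> \<in> s'_set") auto

lemma S_set_bound:
  assumes "x \<in> S_set"
  obtains C where "0 \<le> C" "\<And>\<xi>. s'_summ m \<xi> \<Longrightarrow> snorm n (x \<xi>) \<le> C * s'norm m \<xi>"
proof -
  obtain C where C: "\<And>\<xi>. s'_summ m \<xi> \<Longrightarrow> snorm n (x \<xi>) \<le> C * s'norm m \<xi>"
    using assms unfolding S_set_def by blast
  have "snorm n (x \<xi>) \<le> max C 0 * s'norm m \<xi>" if "s'_summ m \<xi>" for \<xi>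
    using C[OF that] mult_right_mono[OF max.cobounded1[of C 0] s'norm_nonneg[OF that]] by linarith
  then show ?thesis using that[of "max C 0"] by auto
qed

lemma S_set_zero_arg: "x \<in> S_set \<Longrightarrow> x (\<lambda>j. 0) = (\<lambda>j. 0)"
  using S_setD(4)[of x "\<lambda>j. 0" 0] zero_in_s'_set by simp

lemma S_setI:
  assumes "\<And>\<xi>. \<xi> \<notin> s'_set \<Longrightarrow> x \<xi> = (\<lambda>j. 0)"
    and "\<And>\<xi>. \<xi> \<in> s'_set \<Longrightarrow> x \<xi> \<in> s_set"
    and "\<And>\<xi> \<eta>. \<xi> \<in> s'_set \<Longrightarrow> \<eta> \<in> s'_set \<Longrightarrow> x (\<lambda>j. \<xi> j + \<eta> j) = (\<lambda>j. x \<xi> j + x \<eta> j)"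
    and "\<And>\<xi> c. \<xi> \<in> s'_set \<Longrightarrow> x (\<lambda>j. c * \<xi> j) = (\<lambda>j. c * x \<xi> j)"
    and "\<And>m n. \<exists>C. \<forall>\<xi>. s'_summ m \<xi> \<longrightarrow> snorm n (x \<xi>) \<le> C * s'norm m \<xi>"
  shows "x \<in> S_set"
  using assms unfolding S_set_def by blast

lemma S_set_zero: "(\<lambda>\<xi> j. 0) \<in> S_set"
  by (rule S_setI) (auto simp: s_set_zero snorm_zero intro: exI[of _ 0])

lemma S_set_add:
  assumes x: "x \<in> S_set" and y: "y \<in> S_set"
  shows "(\<lambda>\<xi> j. x \<xi> j + y \<xi> j) \<in> S_set"
proof (rule S_setI)
  fix m n
  obtain C where C: "\<And>\<xi>. s'_summ m \<xi> \<Longrightarrow> snorm n (x \<xi>) \<le> C * s'norm m \<xi>"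
    using S_set_bound[OF x] by metis
  obtain D where D: "\<And>\<xi>. s'_summ m \<xi> \<Longrightarrow> snorm n (y \<xi>) \<le> D * s'norm m \<xi>"
    using S_set_bound[OF y] by metis
  have "snorm n (\<lambda>j. x \<xi> j + y \<xi> j) \<le> (C + D) * s'norm m \<xi>" if "s'_summ m \<xi>" for \<xi>
    using C[OF that] D[OF that] snorm_add[OF S_set_in_s[OF x] S_set_in_s[OF y], of n \<xi> \<xi>]
    unfolding distrib_right by linarith
  then show "\<exists>C. \<forall>\<xi>. s'_summ m \<xi> \<longrightarrow> snorm n (\<lambda>j. x \<xi> j + y \<xi> j) \<le> C * s'norm m \<xi>" by blast
qed (use S_set_in_s[OF x] S_set_in_s[OF y] in
  \<open>auto simp: S_setD[OF x] S_setD[OF y] s_set_add algebra_simps\<close>)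

lemma S_set_scale:
  assumes x: "x \<in> S_set"
  shows "(\<lambda>\<xi> j. c * x \<xi> j) \<in> S_set"
proof (rule S_setI)
  fix m n
  obtain C where C: "\<And>\<xi>. s'_summ m \<xi> \<Longrightarrow> snorm n (x \<xi>) \<le> C * s'norm m \<xi>"
    using S_set_bound[OF x] by metis
  have "snorm n (\<lambda>j. c * x \<xi> j) \<le> cmod c * C * s'norm m \<xi>" if "s'_summ m \<xi>" for \<xi>
    using mult_left_mono[OF C[OF that] norm_ge_zero[of c]]
    unfolding snorm_scale[OF S_set_in_s[OF x]] by (simp add: mult.assoc)
  then show "\<exists>C. \<forall>\<xi>. s'_summ m \<xi> \<longrightarrow> snorm n (\<lambda>j. c * x \<xi> j) \<le> C * s'norm m \<xi>" by blast
qed (use S_set_in_s[OF x] in \<open>auto simp: S_setD[OF x] s_set_scale algebra_simps\<close>)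

lemma S_set_opmult:
  assumes x: "x \<in> S_set" and y: "y \<in> S_set"
  shows "opmult x y \<in> S_set"
  unfolding opmult_def o_def
proof (rule S_setI)
  fix m n
  obtain C where C: "0 \<le> C" "\<And>\<xi>. s'_summ 0 \<xi> \<Longrightarrow> snorm n (x \<xi>) \<le> C * s'norm 0 \<xi>"
    using S_set_bound[OF x] by metis
  obtain D where D: "\<And>\<xi>. s'_summ m \<xi> \<Longrightarrow> snorm 0 (y \<xi>) \<le> D * s'norm m \<xi>"
    using S_set_bound[OF y] by metis
  have "snorm n (x (y \<xi>)) \<le> C * D * s'norm m \<xi>" if "s'_summ m \<xi>" for \<xi>
    using C(2)[OF s'_summ_of_s[OF S_set_in_s[OF y]], of \<xi>] mult_left_mono[OF D[OF that] C(1)]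
    unfolding s'norm_0 by (simp add: mult.assoc)
  then show "\<exists>C. \<forall>\<xi>. s'_summ m \<xi> \<longrightarrow> snorm n (x (y \<xi>)) \<le> C * s'norm m \<xi>" by blast
qed (use s_set_subset[OF S_set_in_s[OF y]] S_set_in_s[OF x] in
  \<open>auto simp: S_setD[OF x] S_setD[OF y] S_set_zero_arg[OF x]\<close>)

lemma S_set_opsum:
  "(\<And>i. i < m \<Longrightarrow> xs i \<in> S_set) \<Longrightarrow> opsum m xs \<in> S_set"
proof (induction m)
  case 0
  then show ?case by (simp add: opsum_def S_set_zero)
next
  case (Suc m)
  have "opsum (Suc m) xs = (\<lambda>\<xi> j. opsum m xs \<xi> j + xs m \<xi> j)"
    by (simp add: opsum_def)
  then show ?case using Suc by (simp add: S_set_add)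
qed

text \<open>Justifies the choice in \<open>adj\<close>: the functional sending \<open>\<eta>\<close>
  to the pairing of \<open>\<xi>\<close> with \<open>x \<eta>\<close> is antilinear. It is
  continuous on each step p, because x maps that step into the norm of order m for the m belonging
  to \<open>\<xi>\<close>.\<close>

lemma adj_spec:
  assumes x: "x \<in> S_set" and \<xi>: "\<xi> \<in> s'_set"
  shows "adj x \<xi> \<in> s_set" and "\<eta> \<in> s'_set \<Longrightarrow> pair (adj x \<xi>) \<eta> = pair \<xi> (x \<eta>)"
proof -
  have "\<exists>z\<in>s_set. \<forall>\<eta>\<in>s'_set. pair z \<eta> = pair \<xi> (x \<eta>)"
  proof (rule s_Riesz)
    fix p
    obtain m where m: "s'_summ m \<xi>" using \<xi> by (auto simp: s'_set_def)
    obtain C where C: "\<And>\<eta>. s'_summ p \<eta> \<Longrightarrow> snorm m (x \<eta>) \<le> C * s'norm p \<eta>"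
      using S_set_bound[OF x] by metis
    have "cmod (pair \<xi> (x \<eta>)) \<le> C * s'norm m \<xi> * s'norm p \<eta>" if "s'_summ p \<eta>" for \<eta>
      using pair_bound[OF S_set_in_s[OF x] m, of \<eta>] mult_right_mono[OF C[OF that] s'norm_nonneg[OF m]]
        pair_commute[OF S_set_in_s[OF x] \<xi>, of \<eta>] by (simp add: mult_ac)
    then show "\<exists>C. \<forall>\<eta>. s'_summ p \<eta> \<longrightarrow> cmod (pair \<xi> (x \<eta>)) \<le> C * s'norm p \<eta>" by blast
  qed (use S_set_in_s[OF x] \<xi> in
    \<open>auto simp: S_setD[OF x] pair_commute s_set_add s_set_scale pair_add_left pair_scale_left\<close>)
  then have ex: "\<exists>z. z \<in> s_set \<and> (\<forall>\<eta>\<in>s'_set. pair z \<eta> = pair \<xi> (x \<eta>))" by blast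
  from someI_ex[OF ex] \<xi>
  show "adj x \<xi> \<in> s_set" and "\<eta> \<in> s'_set \<Longrightarrow> pair (adj x \<xi>) \<eta> = pair \<xi> (x \<eta>)"
    by (auto simp: adj_def)
qed

lemma adj_outside: "\<xi> \<notin> s'_set \<Longrightarrow> adj x \<xi> = (\<lambda>j. 0)"
  by (simp add: adj_def)

text \<open>Pairing with coordinate vectors recovers the entries, so identities for
  \<open>adj\<close> reduce to identities between pairings.\<close>

lemma adj_eqI:
  assumes "x \<in> S_set" "\<xi> \<in> s'_set" "\<And>\<eta>. \<eta> \<in> s'_set \<Longrightarrow> pair z \<eta> = pair \<xi> (x \<eta>)"
  shows "adj x \<xi> = z"
proof
  fix k
  have "pair (adj x \<xi>) (unit_sq k) = pair z (unit_sq k)"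
    using adj_spec(2)[OF assms(1,2) unit_sq_in_s'_set] assms(3)[OF unit_sq_in_s'_set] by simp
  then show "adj x \<xi> k = z k" by (simp add: pair_unit_sq)
qed

lemma pair_add_left_s':
  assumes "z \<in> s_set" "\<xi> \<in> s'_set" "\<eta> \<in> s'_set"
  shows "pair (\<lambda>j. \<xi> j + \<eta> j) z = pair \<xi> z + pair \<eta> z"
  using assms by (simp add: pair_commute s'_set_add pair_add_right)

lemma pair_scale_left_s':
  assumes "z \<in> s_set" "\<xi> \<in> s'_set"
  shows "pair (\<lambda>j. c * \<xi> j) z = c * pair \<xi> z"
  using assms by (simp add: pair_commute s'_set_scale pair_scale_right)

text \<open>By duality the two orders exchange roles: the constant with which x maps the step n into
  the norm m serves \<open>adj x\<close> from the step m into the norm n.\<close>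

lemma S_set_adj:
  assumes x: "x \<in> S_set"
  shows "adj x \<in> S_set"
proof (rule S_setI)
  fix m n
  obtain C where C: "0 \<le> C" "\<And>\<eta>. s'_summ n \<eta> \<Longrightarrow> snorm m (x \<eta>) \<le> C * s'norm n \<eta>"
    using S_set_bound[OF x] by metis
  have "snorm n (adj x \<xi>) \<le> C * s'norm m \<xi>" if m: "s'_summ m \<xi>" for \<xi>
  proof (rule snorm_le_dual)
    show "adj x \<xi> \<in> s_set" by (rule adj_spec(1)[OF x s'_setI[OF m]])
    fix \<eta> assume \<eta>: "\<eta> \<in> s'ball n"
    have "cmod (pair (adj x \<xi>) \<eta>) = cmod (pair (x \<eta>) \<xi>)"
      using adj_spec(2)[OF x s'_setI[OF m] s'ball_in_s'_set[OF \<eta>]]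
        pair_commute[OF S_set_in_s[OF x] s'_setI[OF m], of \<eta>] by simp
    also have "\<dots> \<le> snorm m (x \<eta>) * s'norm m \<xi>"
      by (rule pair_bound[OF S_set_in_s[OF x] m])
    also have "snorm m (x \<eta>) \<le> C * s'norm n \<eta>" using C(2) \<eta> by (simp add: s'ball_def)
    also have "C * s'norm n \<eta> \<le> C * 1"
      using \<eta> C(1) by (intro mult_left_mono) (auto simp: s'ball_def)
    finally show "cmod (pair (adj x \<xi>) \<eta>) \<le> C * s'norm m \<xi>"
      using s'norm_nonneg[OF m] by (simp add: mult_right_mono)
  qed
  then show "\<exists>C. \<forall>\<xi>. s'_summ m \<xi> \<longrightarrow> snorm n (adj x \<xi>) \<le> C * s'norm m \<xi>" by blast
next
  fix \<xi> \<eta> assume *: "\<xi> \<in> s'_set" "\<eta> \<in> s'_set"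
  show "adj x (\<lambda>j. \<xi> j + \<eta> j) = (\<lambda>j. adj x \<xi> j + adj x \<eta> j)"
    by (rule adj_eqI[OF x])
      (use * S_set_in_s[OF x] in \<open>simp_all add: s'_set_add pair_add_left pair_add_left_s' adj_spec[OF x]\<close>)
next
  fix \<xi> c assume *: "\<xi> \<in> s'_set"
  show "adj x (\<lambda>j. c * \<xi> j) = (\<lambda>j. c * adj x \<xi> j)"
    by (rule adj_eqI[OF x])
      (use * S_set_in_s[OF x] in \<open>simp_all add: s'_set_scale pair_scale_left pair_scale_left_s' adj_spec[OF x]\<close>)
qed (auto simp: adj_outside adj_spec[OF x])

lemma adj_eq_opI:
  assumes "x \<in> S_set" "z \<in> S_set"
    "\<And>\<xi> \<eta>. \<xi> \<in> s'_set \<Longrightarrow> \<eta> \<in> s'_set \<Longrightarrow> pair (z \<xi>) \<eta> = pair \<xi> (x \<eta>)"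
  shows "adj x = z"
proof
  fix \<xi> show "adj x \<xi> = z \<xi>"
    using assms by (cases "\<xi> \<in> s'_set") (auto simp: adj_outside S_setD(1) intro!: adj_eqI)
qed

lemma adj_adj:
  assumes x: "x \<in> S_set"
  shows "adj (adj x) = x"
proof (rule adj_eq_opI[OF S_set_adj[OF x] x])
  fix \<xi> \<eta> assume *: "\<xi> \<in> s'_set" "\<eta> \<in> s'_set"
  then show "pair (x \<xi>) \<eta> = pair \<xi> (adj x \<eta>)"
    using adj_spec[OF x *(2)] pair_commute[OF S_set_in_s[OF x], of \<eta> \<xi>]
    by (simp add: pair_commute[OF adj_spec(1)[OF x *(2)] *(1)])
qed

lemma adj_add:
  assumes x: "x \<in> S_set" and y: "y \<in> S_set"
  shows "adj (\<lambda>\<xi> j. x \<xi> j + y \<xi> j) = (\<lambda>\<xi> j. adj x \<xi> j + adj y \<xi> j)"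
  by (rule adj_eq_opI)
    (use S_set_in_s[OF x] S_set_in_s[OF y] in
      \<open>simp_all add: S_set_add S_set_adj x y pair_add_left adj_spec pair_add_right pair_commute s_set_add\<close>)

lemma adj_scale:
  assumes x: "x \<in> S_set"
  shows "adj (\<lambda>\<xi> j. c * x \<xi> j) = (\<lambda>\<xi> j. cnj c * adj x \<xi> j)"
  by (rule adj_eq_opI)
    (use S_set_in_s[OF x] in
      \<open>simp_all add: S_set_scale S_set_adj x pair_scale_left adj_spec pair_commute s_set_scale\<close>)

section \<open>The operator seminorms\<close>

lemma opnorm_bdd:
  assumes x: "x \<in> S_set"
  shows "bdd_above {snorm n (x \<xi>) | \<xi>. \<xi> \<in> s'ball n}"
proof -
  obtain C where C: "0 \<le> C" "\<And>\<xi>. s'_summ n \<xi> \<Longrightarrow> snorm n (x \<xi>) \<le> C * s'norm n \<xi>"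
    using S_set_bound[OF x] by metis
  have "snorm n (x \<xi>) \<le> C" if "\<xi> \<in> s'ball n" for \<xi>
    using that C(2)[of \<xi>] mult_left_mono[of "s'norm n \<xi>" 1 C] C(1) by (auto simp: s'ball_def)
  then show ?thesis by (auto simp: bdd_above_def)
qed

lemma snorm_le_opnorm:
  assumes "x \<in> S_set" "\<xi> \<in> s'ball n"
  shows "snorm n (x \<xi>) \<le> opnorm n x"
  unfolding opnorm_def by (rule cSup_upper[OF _ opnorm_bdd[OF assms(1)]]) (use assms in auto)

lemma opnorm_le:
  assumes "\<And>\<xi>. \<xi> \<in> s'ball n \<Longrightarrow> snorm n (x \<xi>) \<le> M"
  shows "opnorm n x \<le> M"
  unfolding opnorm_def by (rule cSup_least) (use assms zero_in_s'ball in auto)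

lemma opnorm_nonneg: "x \<in> S_set \<Longrightarrow> 0 \<le> opnorm n x"
  using snorm_le_opnorm[OF _ zero_in_s'ball, of x n] S_set_zero_arg[of x] by (simp add: snorm_zero)

lemma opnorm_zero: "opnorm n (\<lambda>\<xi> j. 0) = 0"
  by (rule antisym[OF opnorm_le opnorm_nonneg[OF S_set_zero]]) (simp add: snorm_zero)

lemma opnorm_scale:
  assumes x: "x \<in> S_set"
  shows "opnorm n (\<lambda>\<xi> j. c * x \<xi> j) \<le> cmod c * opnorm n x"
  by (rule opnorm_le)
    (auto simp: snorm_scale[OF S_set_in_s[OF x]] intro!: mult_left_mono snorm_le_opnorm[OF x])

lemma opnorm_adj_le:
  assumes x: "x \<in> S_set"
  shows "opnorm n (adj x) \<le> opnorm n x"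
proof (rule opnorm_le, rule snorm_le_dual)
  fix \<xi> \<eta> assume \<xi>: "\<xi> \<in> s'ball n" and \<eta>: "\<eta> \<in> s'ball n"
  have "cmod (pair (adj x \<xi>) \<eta>) = cmod (pair (x \<eta>) \<xi>)"
    using adj_spec(2)[OF x s'ball_in_s'_set[OF \<xi>] s'ball_in_s'_set[OF \<eta>]]
      pair_commute[OF S_set_in_s[OF x] s'ball_in_s'_set[OF \<xi>], of \<eta>] by simp
  also have "\<dots> \<le> snorm n (x \<eta>) * s'norm n \<xi>"
    using \<xi> by (intro pair_bound[OF S_set_in_s[OF x]]) (simp add: s'ball_def)
  also have "\<dots> \<le> snorm n (x \<eta>) * 1"
    using \<xi> by (intro mult_left_mono snorm_nonneg S_set_in_s[OF x]) (auto simp: s'ball_def)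
  finally show "cmod (pair (adj x \<xi>) \<eta>) \<le> opnorm n x"
    using snorm_le_opnorm[OF x \<eta>] by simp
qed (rule S_set_in_s[OF S_set_adj[OF x]])

lemma opnorm_adj: "x \<in> S_set \<Longrightarrow> opnorm n (adj x) = opnorm n x"
  using opnorm_adj_le[of x n] opnorm_adj_le[OF S_set_adj, of x n] by (simp add: adj_adj)

section \<open>Gram operators and Hilbert--Schmidt bounds\<close>

lemma pair_opsum:
  assumes "\<forall>i<m. xs i \<in> S_set" "\<xi> \<in> s'_set"
  shows "pair (opsum m xs \<eta>) \<xi> = (\<Sum>i<m. pair (xs i \<eta>) \<xi>)"
  using assms(1)
proof (induction m)
  case 0
  then show ?case by (simp add: opsum_def pair_def)
next
  case (Suc m)
  have "opsum (Suc m) xs \<eta> = (\<lambda>j. opsum m xs \<eta> j + xs m \<eta> j)"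
    by (simp add: opsum_def)
  then show ?case
    using Suc S_set_in_s[OF S_set_opsum[of m xs], of \<eta>] S_set_in_s[of "xs m" \<eta>] assms(2)
    by (simp add: pair_add_left)
qed

lemma pair_adj_mult:
  assumes "x \<in> S_set" "\<xi> \<in> s'_set"
  shows "pair (opmult (adj x) x \<eta>) \<xi> = pair (x \<eta>) (x \<xi>)"
  using assms adj_spec(2)[OF assms(1) s_set_subset[OF S_set_in_s[OF assms(1)]]]
  by (simp add: opmult_def)

lemma phi_opmult_adj:
  assumes "x \<in> S_set" "\<xi> \<in> s'_set"
  shows "phi \<xi> (opmult (adj x) x) = complex_of_real ((snorm 0 (x \<xi>))\<^sup>2)"
  using pair_adj_mult[OF assms, of \<xi>] pair_self[OF S_set_in_s[OF assms(1)]] by (simp add: phi_def)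

lemma phi_opmult_adj_right:
  assumes "x \<in> S_set" "\<xi> \<in> s'_set"
  shows "phi \<xi> (opmult x (adj x)) = complex_of_real ((snorm 0 (adj x \<xi>))\<^sup>2)"
  using phi_opmult_adj[OF S_set_adj[OF assms(1)] assms(2)] by (simp add: adj_adj[OF assms(1)])

text \<open>Both halves of \<open>rcnorm\<close> have this form, one for the family and one for its
  adjoints, so each estimate on positive sums is proved only once.\<close>

definition gram :: "nat \<Rightarrow> (nat \<Rightarrow> op) \<Rightarrow> op" where
  "gram m xs = opsum m (\<lambda>i. opmult (adj (xs i)) (xs i))"

lemma rcnorm_gram:
  assumes "\<forall>i<m. xs i \<in> S_set"
  shows "rcnorm k m xs = max (sqrt (opnorm k (gram m xs))) (sqrt (opnorm k (gram m (\<lambda>i. adj (xs i)))))"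
proof -
  have "opsum m (\<lambda>i. opmult (xs i) (adj (xs i))) = gram m (\<lambda>i. adj (xs i))"
    using assms by (simp add: gram_def opsum_def adj_adj cong: sum.cong_simp)
  then show ?thesis by (simp add: rcnorm_def gram_def)
qed

lemma gram_in_S_set:
  "\<forall>i<m. xs i \<in> S_set \<Longrightarrow> gram m xs \<in> S_set"
  unfolding gram_def by (intro S_set_opsum S_set_opmult S_set_adj) auto

lemma pair_gram:
  assumes "\<forall>i<m. xs i \<in> S_set" "\<xi> \<in> s'_set"
  shows "pair (gram m xs \<eta>) \<xi> = (\<Sum>i<m. pair (xs i \<eta>) (xs i \<xi>))"
proof -
  have "pair (gram m xs \<eta>) \<xi> = (\<Sum>i<m. pair (opmult (adj (xs i)) (xs i) \<eta>) \<xi>)"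
    unfolding gram_def by (rule pair_opsum) (use assms in \<open>simp_all add: S_set_opmult S_set_adj\<close>)
  also have "\<dots> = (\<Sum>i<m. pair (xs i \<eta>) (xs i \<xi>))"
    by (rule sum.cong) (use assms in \<open>simp_all add: pair_adj_mult\<close>)
  finally show ?thesis .
qed

lemma pair_gram_self:
  assumes "\<forall>i<m. xs i \<in> S_set" "\<xi> \<in> s'_set"
  shows "pair (gram m xs \<xi>) \<xi> = complex_of_real (\<Sum>i<m. (snorm 0 (xs i \<xi>))\<^sup>2)"
  unfolding pair_gram[OF assms] of_real_sum
  by (rule sum.cong) (use assms in \<open>simp_all add: pair_self S_set_in_s del: of_real_power\<close>)

text \<open>A positive operator is controlled by its diagonal values: Cauchy--Schwarz in each vector
  and again in the index i bounds a mixed pairing by the product of two diagonal square roots, and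
  duality turns mixed pairings into the seminorm.\<close>

lemma opnorm_gram_le:
  assumes xs: "\<forall>i<m. xs i \<in> S_set"
    and M: "\<And>\<xi>. \<xi> \<in> s'ball k \<Longrightarrow> (\<Sum>i<m. (snorm 0 (xs i \<xi>))\<^sup>2) \<le> M"
  shows "opnorm k (gram m xs) \<le> M"
proof (rule opnorm_le, rule snorm_le_dual)
  fix \<xi> \<eta> assume \<xi>: "\<xi> \<in> s'ball k" and \<eta>: "\<eta> \<in> s'ball k"
  have M0: "0 \<le> M" using M[OF \<xi>] by (meson order_trans sum_nonneg zero_le_power2)
  have L2: "L2_set (\<lambda>i. snorm 0 (xs i \<zeta>)) {..<m} \<le> sqrt M" if "\<zeta> \<in> s'ball k" for \<zeta>
    unfolding L2_set_def using M[OF that] by simp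
  have "cmod (pair (gram m xs \<xi>) \<eta>) \<le> (\<Sum>i<m. cmod (pair (xs i \<xi>) (xs i \<eta>)))"
    unfolding pair_gram[OF xs s'ball_in_s'_set[OF \<eta>]] by (rule norm_sum)
  also have "\<dots> \<le> (\<Sum>i<m. \<bar>snorm 0 (xs i \<xi>)\<bar> * \<bar>snorm 0 (xs i \<eta>)\<bar>)"
  proof (rule sum_mono)
    fix i assume "i \<in> {..<m}"
    then have *: "xs i \<zeta> \<in> s_set" for \<zeta> using S_set_in_s xs by auto
    show "cmod (pair (xs i \<xi>) (xs i \<eta>)) \<le> \<bar>snorm 0 (xs i \<xi>)\<bar> * \<bar>snorm 0 (xs i \<eta>)\<bar>"
      using pair_bound[OF * s'_summ_of_s[OF *], of \<xi> \<eta>] snorm_nonneg[OF *] by (simp add: s'norm_0)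
  qed
  also have "\<dots> \<le> L2_set (\<lambda>i. snorm 0 (xs i \<xi>)) {..<m} * L2_set (\<lambda>i. snorm 0 (xs i \<eta>)) {..<m}"
    by (rule L2_set_mult_ineq)
  also have "\<dots> \<le> sqrt M * sqrt M"
    by (intro mult_mono L2 \<xi> \<eta>) (auto simp: M0)
  finally show "cmod (pair (gram m xs \<xi>) \<eta>) \<le> M" using M0 by simp
qed (rule S_set_in_s[OF gram_in_S_set[OF xs]])

text \<open>The k-th coordinate vector has dual norm \<open>(k+1)^(-p)\<close>, so its multiple by
  \<open>(k+1)^p\<close> lies in the ball of order p. The diagonal value is quadratic in the vector,
  which doubles the exponent.\<close>

lemma gram_unit_sq_bound:
  assumes xs: "\<forall>i<m. xs i \<in> S_set"
  shows "(\<Sum>i<m. (snorm 0 (xs i (unit_sq k)))\<^sup>2) \<le> opnorm p (gram m xs) / real (Suc k) ^ (2*p)"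
proof -
  define e where "e = unit_sq k"
  define w where "w = (real (Suc k)) ^ p"
  have w: "w > 0" by (simp add: w_def)
  have e: "e \<in> s'_set" "s'_summ p e" unfolding e_def by (rule unit_sq_in_s'_set s'_summ_unit_sq)+
  have "(s'norm p e)\<^sup>2 = (1 / w)\<^sup>2"
    unfolding e_def w_def s'norm_unit_sq_power2 power_divide power_even_eq by simp
  then have norm_e: "s'norm p e = 1 / w"
    by (rule power2_eq_imp_eq) (use s'norm_nonneg[OF e(2)] w in simp_all)
  define e' where "e' = (\<lambda>j. complex_of_real w * e j)"
  have e': "e' \<in> s'ball p"
    using s'_summ_scale[OF e(2), of "complex_of_real w"] s'norm_scale[OF e(2), of "complex_of_real w"] w
    by (simp add: s'ball_def e'_def norm_e)
  have G: "gram m xs \<in> S_set" by (rule gram_in_S_set[OF xs])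
  have "(\<Sum>i<m. (snorm 0 (xs i e'))\<^sup>2) = w\<^sup>2 * (\<Sum>i<m. (snorm 0 (xs i e))\<^sup>2)"
    unfolding sum_distrib_left
    by (rule sum.cong)
      (use xs in \<open>auto simp: e'_def S_setD(4) e(1) snorm_scale S_set_in_s power_mult_distrib\<close>)
  moreover have "complex_of_real (\<Sum>i<m. (snorm 0 (xs i e'))\<^sup>2) = pair (gram m xs e') e'"
    using pair_gram_self[OF xs s'ball_in_s'_set[OF e']] by simp
  moreover have "cmod (pair (gram m xs e') e') \<le> opnorm p (gram m xs)"
  proof -
    have "cmod (pair (gram m xs e') e') \<le> snorm p (gram m xs e') * s'norm p e'"
      using e' by (intro pair_bound S_set_in_s[OF G]) (simp add: s'ball_def)
    also have "\<dots> \<le> snorm p (gram m xs e') * 1"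
      using e' by (intro mult_left_mono snorm_nonneg S_set_in_s[OF G]) (simp add: s'ball_def)
    finally show ?thesis using snorm_le_opnorm[OF G e'] by simp
  qed
  ultimately have le: "w\<^sup>2 * (\<Sum>i<m. (snorm 0 (xs i e))\<^sup>2) \<le> opnorm p (gram m xs)"
    by (metis norm_of_real abs_le_D1)
  have "(\<Sum>i<m. (snorm 0 (xs i e))\<^sup>2) = w\<^sup>2 * (\<Sum>i<m. (snorm 0 (xs i e))\<^sup>2) / w\<^sup>2" using w by simp
  also have "\<dots> \<le> opnorm p (gram m xs) / w\<^sup>2" by (intro divide_right_mono le) simp
  finally show ?thesis unfolding e_def w_def power_even_eq .
qed

text \<open>The number h is the squared Hilbert--Schmidt norm of \<open>D^n x D^n\<close>, summed by
  rows: entry k of \<open>x \<xi>\<close> is, up to conjugation, the pairing of row k, that is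
  \<open>adj x (unit_sq k)\<close>, with \<open>\<xi>\<close>.\<close>

lemma opnorm_le_Hilbert_Schmidt:
  assumes x: "x \<in> S_set"
    and h: "(\<lambda>k. (snorm n (adj x (unit_sq k)))\<^sup>2 * real (Suc k) ^ (2*n)) sums h"
  shows "(opnorm n x)\<^sup>2 \<le> h"
proof -
  have h0: "0 \<le> h" using h by (rule sums_le[OF _ sums_zero, rotated]) auto
  have "opnorm n x \<le> sqrt h"
  proof (rule opnorm_le)
    fix \<xi> assume \<xi>: "\<xi> \<in> s'ball n"
    note \<xi>' = s'ball_in_s'_set[OF \<xi>]
    have entry: "cmod (x \<xi> k) \<le> snorm n (adj x (unit_sq k))" for k
    proof -
      let ?a = "adj x (unit_sq k)"
      have a: "?a \<in> s_set" by (rule S_set_in_s[OF S_set_adj[OF x]])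
      have "cmod (x \<xi> k) = cmod (pair ?a \<xi>)"
        using adj_spec(2)[OF x unit_sq_in_s'_set \<xi>'] pair_commute[OF S_set_in_s[OF x] unit_sq_in_s'_set]
        by (simp add: pair_unit_sq)
      also have "\<dots> \<le> snorm n ?a * s'norm n \<xi>" using \<xi> by (intro pair_bound a) (simp add: s'ball_def)
      also have "\<dots> \<le> snorm n ?a * 1"
        using \<xi> by (intro mult_left_mono snorm_nonneg a) (simp add: s'ball_def)
      finally show ?thesis by simp
    qed
    have "(snorm n (x \<xi>))\<^sup>2 \<le> h"
      by (rule sums_le[OF _ snorm_power2[OF S_set_in_s[OF x]] h])
        (intro mult_right_mono power_mono entry; simp)
    then show "snorm n (x \<xi>) \<le> sqrt h" by (rule real_le_rsqrt)
  qed
  then show ?thesis using power_mono[OF _ opnorm_nonneg[OF x], of n "sqrt h" 2] h0 by simp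
qed

section \<open>Summing matrix entries over a finite family\<close>

lemma adj_entry:
  assumes x: "x \<in> S_set"
  shows "cmod (adj x (unit_sq k) l) = cmod (x (unit_sq l) k)"
proof -
  have "adj x (unit_sq k) l = pair (unit_sq k) (x (unit_sq l))"
    using adj_spec(2)[OF x unit_sq_in_s'_set unit_sq_in_s'_set, of k l] by (simp add: pair_unit_sq)
  also have "\<dots> = cnj (x (unit_sq l) k)"
    using pair_commute[OF S_set_in_s[OF x] unit_sq_in_s'_set] by (simp add: pair_unit_sq)
  finally show ?thesis by simp
qed

text \<open>This is zeta(2) = \<open>pi^2/6\<close>; it will turn out to be an admissible
  Grothendieck constant for every n at once.\<close>

definition zeta2 :: real where
  "zeta2 = (\<Sum>k. 1 / real (Suc k) ^ 2)"

lemma sum_inverse_squares_le: "(\<Sum>k<N. 1 / real (Suc k) ^ 2) \<le> zeta2"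
  unfolding zeta2_def
proof (rule sum_le_suminf)
  show "summable (\<lambda>k. 1 / real (Suc k) ^ 2)"
    using inverse_power_summable[of 2, where 'a = real] summable_Suc_iff[of "\<lambda>n. inverse (real n ^ 2)"]
    by (simp add: divide_inverse)
qed auto

lemma zeta2_nonneg: "0 \<le> zeta2"
  using sum_inverse_squares_le[of 0] by simp

lemma snorm_0_partial:
  "z \<in> s_set \<Longrightarrow> (\<Sum>l<N. (cmod (z l))\<^sup>2) \<le> (snorm 0 z)\<^sup>2"
  using snorm_power2[of z 0] sum_le_suminf[of "\<lambda>l. (cmod (z l))\<^sup>2" "{..<N}"] by (auto simp: sums_iff)

text \<open>The arithmetic-geometric mean inequality separates the mixed weight into a part
  depending on k only and a part depending on l only. The first meets the row sums, the second the
  column sums, and either way the powers \<open>4n\<close> cancel and inverse squares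
  remain.\<close>

lemma weighted_double_sum_bound:
  fixes T :: "nat \<Rightarrow> nat \<Rightarrow> nat \<Rightarrow> real" and R :: real
  assumes R: "0 \<le> R" and T: "\<And>i k l. 0 \<le> T i k l"
    and row: "\<And>k. (\<Sum>i<m. \<Sum>l<M. T i k l) \<le> R / real (Suc k) ^ (4*n+2)"
    and col: "\<And>l. (\<Sum>i<m. \<Sum>k<N. T i k l) \<le> R / real (Suc l) ^ (4*n+2)"
  shows "(\<Sum>i<m. \<Sum>k<N. \<Sum>l<M. real (Suc k) ^ (2*n) * real (Suc l) ^ (2*n) * T i k l) \<le> zeta2 * R"
proof -
  define K where "K k = real (Suc k) ^ (2*n)" for k
  have K2: "(K k)\<^sup>2 * (R / real (Suc k) ^ (4*n+2)) = R * (1 / real (Suc k) ^ 2)" for k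
  proof -
    have "(K k)\<^sup>2 = real (Suc k) ^ (4*n)" by (simp add: K_def power_mult[symmetric] mult_ac)
    then show ?thesis by (simp add: power_add power2_eq_square del: of_nat_Suc)
  qed
  have pt: "K k * K l * T i k l \<le> ((K k)\<^sup>2 * T i k l + (K l)\<^sup>2 * T i k l) / 2" for i k l
    using mult_right_mono[OF sum_squares_bound[of "K k" "K l"] T[of i k l]]
    by (simp add: algebra_simps)
  have "(\<Sum>i<m. \<Sum>k<N. \<Sum>l<M. K k * K l * T i k l)
      \<le> (\<Sum>i<m. \<Sum>k<N. \<Sum>l<M. ((K k)\<^sup>2 * T i k l + (K l)\<^sup>2 * T i k l) / 2)"
    by (intro sum_mono pt)
  also have "\<dots> = ((\<Sum>i<m. \<Sum>k<N. \<Sum>l<M. (K k)\<^sup>2 * T i k l) + (\<Sum>i<m. \<Sum>k<N. \<Sum>l<M. (K l)\<^sup>2 * T i k l)) / 2"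
    by (simp add: sum.distrib sum_divide_distrib add_divide_distrib)
  also have "(\<Sum>i<m. \<Sum>k<N. \<Sum>l<M. (K k)\<^sup>2 * T i k l) = (\<Sum>k<N. (K k)\<^sup>2 * (\<Sum>i<m. \<Sum>l<M. T i k l))"
    unfolding sum_distrib_left by (subst sum.swap) (rule refl)
  also have "(\<Sum>i<m. \<Sum>k<N. \<Sum>l<M. (K l)\<^sup>2 * T i k l) = (\<Sum>l<M. (K l)\<^sup>2 * (\<Sum>i<m. \<Sum>k<N. T i k l))"
    unfolding sum_distrib_left
    by (subst sum.swap[of _ "{..<M}"], subst sum.swap[of _ "{..<M}"]) (rule refl)
  also have "((\<Sum>k<N. (K k)\<^sup>2 * (\<Sum>i<m. \<Sum>l<M. T i k l)) + (\<Sum>l<M. (K l)\<^sup>2 * (\<Sum>i<m. \<Sum>k<N. T i k l))) / 2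
      \<le> ((\<Sum>k<N. (K k)\<^sup>2 * (R / real (Suc k) ^ (4*n+2))) + (\<Sum>l<M. (K l)\<^sup>2 * (R / real (Suc l) ^ (4*n+2)))) / 2"
    by (intro divide_right_mono add_mono sum_mono mult_left_mono row col) auto
  also have "\<dots> = R * ((\<Sum>k<N. 1 / real (Suc k) ^ 2) + (\<Sum>l<M. 1 / real (Suc l) ^ 2)) / 2"
    unfolding K2 sum_distrib_left[symmetric] by (simp add: distrib_left)
  also have "\<dots> \<le> R * (zeta2 + zeta2) / 2"
    by (intro divide_right_mono mult_left_mono add_mono sum_inverse_squares_le R) auto
  finally show ?thesis unfolding K_def by (simp add: mult_ac)
qed

text \<open>Row sums of squared entries are diagonal values of the Gram operator of the adjoints,
  column sums are those of the Gram operator of the family itself. Hence both halves of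
  \<open>rcnorm\<close> enter.\<close>

lemma sum_opnorm_power2_le:
  assumes xs: "\<forall>i<m. xs i \<in> S_set"
  shows "(\<Sum>i<m. (opnorm n (xs i))\<^sup>2) \<le> zeta2 * (rcnorm (2*n+1) m xs)\<^sup>2"
proof -
  define p where "p = 2*n+1"
  define R where "R = (rcnorm p m xs)\<^sup>2"
  have G: "gram m xs \<in> S_set" "gram m (\<lambda>i. adj (xs i)) \<in> S_set"
    using xs by (auto intro!: gram_in_S_set S_set_adj)
  have R: "opnorm p (gram m xs) \<le> R" "opnorm p (gram m (\<lambda>i. adj (xs i))) \<le> R"
    unfolding R_def rcnorm_gram[OF xs]
    by (intro sqrt_le_D max.cobounded1 max.cobounded2)+
  have p2: "2*p = 4*n+2" by (simp add: p_def)
  define T where "T i k l = (if i < m then (cmod (adj (xs i) (unit_sq k) l))\<^sup>2 else 0)" for i k l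
  have row: "(\<Sum>i<m. \<Sum>l<M. T i k l) \<le> R / real (Suc k) ^ (4*n+2)" for k M
  proof -
    have "(\<Sum>i<m. \<Sum>l<M. T i k l) \<le> (\<Sum>i<m. (snorm 0 (adj (xs i) (unit_sq k)))\<^sup>2)"
      by (intro sum_mono) (use xs in \<open>simp add: T_def snorm_0_partial S_set_in_s S_set_adj\<close>)
    also have "\<dots> \<le> opnorm p (gram m (\<lambda>i. adj (xs i))) / real (Suc k) ^ (2*p)"
      by (rule gram_unit_sq_bound[where xs = "\<lambda>i. adj (xs i)"]) (use xs S_set_adj in auto)
    also have "\<dots> \<le> R / real (Suc k) ^ (2*p)" by (intro divide_right_mono R) simp
    finally show ?thesis unfolding p2 .
  qed
  have col: "(\<Sum>i<m. \<Sum>k<N. T i k l) \<le> R / real (Suc l) ^ (4*n+2)" for l N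
  proof -
    have "(\<Sum>i<m. \<Sum>k<N. T i k l) \<le> (\<Sum>i<m. (snorm 0 (xs i (unit_sq l)))\<^sup>2)"
      by (intro sum_mono) (use xs in \<open>simp add: T_def adj_entry snorm_0_partial S_set_in_s\<close>)
    also have "\<dots> \<le> opnorm p (gram m xs) / real (Suc l) ^ (2*p)"
      by (rule gram_unit_sq_bound[OF xs])
    also have "\<dots> \<le> R / real (Suc l) ^ (2*p)" by (intro divide_right_mono R) simp
    finally show ?thesis unfolding p2 .
  qed
  have bound: "(\<Sum>i<m. \<Sum>k<N. \<Sum>l<M. real (Suc k) ^ (2*n) * real (Suc l) ^ (2*n) * T i k l) \<le> zeta2 * R"
    for N M by (rule weighted_double_sum_bound[OF _ _ row col]) (auto simp: R_def T_def)
  define A where "A i = (\<lambda>k. (snorm n (adj (xs i) (unit_sq k)))\<^sup>2 * real (Suc k) ^ (2*n))" for i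
  \<comment> \<open>Letting the column cutoff M tend to infinity turns the finite blocks into full
    row norms. The row cutoff N can go to infinity only after each series is known to
    converge.\<close>
  have partial: "(\<Sum>i<m. \<Sum>k<N. A i k) \<le> zeta2 * R" for N
  proof (rule LIMSEQ_le_const2)
    have "(\<lambda>M. \<Sum>l<M. real (Suc k) ^ (2*n) * real (Suc l) ^ (2*n) * T i k l) \<longlonglongrightarrow> A i k"
      if "i < m" for i k
    proof -
      have "(\<lambda>l. (cmod (adj (xs i) (unit_sq k) l))\<^sup>2 * real (Suc l) ^ (2*n) * real (Suc k) ^ (2*n)) sums A i k"
        unfolding A_def using xs that by (intro sums_mult2 snorm_power2 S_set_in_s S_set_adj) auto
      then show ?thesis using that unfolding sums_def T_def by (simp add: mult_ac)
    qed
    then show "(\<lambda>M. \<Sum>i<m. \<Sum>k<N. \<Sum>l<M. real (Suc k) ^ (2*n) * real (Suc l) ^ (2*n) * T i k l)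
        \<longlonglongrightarrow> (\<Sum>i<m. \<Sum>k<N. A i k)" by (intro tendsto_sum) auto
  qed (use bound in blast)
  have A0: "0 \<le> A i k" for i k by (simp add: A_def)
  have summ: "summable (A i)" if "i < m" for i
  proof (rule summableI_nonneg_bounded[OF A0])
    fix N
    have "(\<Sum>k<N. A i k) \<le> (\<Sum>i<m. \<Sum>k<N. A i k)"
      using that by (intro member_le_sum[where f = "\<lambda>i. \<Sum>k<N. A i k"]) (auto intro!: sum_nonneg A0)
    then show "(\<Sum>k<N. A i k) \<le> zeta2 * R" using partial[of N] by linarith
  qed
  have "(\<Sum>i<m. (opnorm n (xs i))\<^sup>2) \<le> (\<Sum>i<m. suminf (A i))"
  proof (rule sum_mono)
    fix i assume "i \<in> {..<m}"
    then have "xs i \<in> S_set" and "A i sums suminf (A i)" using xs summ by auto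
    then show "(opnorm n (xs i))\<^sup>2 \<le> suminf (A i)"
      unfolding A_def by (rule opnorm_le_Hilbert_Schmidt)
  qed
  also have "\<dots> \<le> zeta2 * R"
  proof (rule LIMSEQ_le_const2)
    show "(\<lambda>N. \<Sum>i<m. \<Sum>k<N. A i k) \<longlonglongrightarrow> (\<Sum>i<m. suminf (A i))"
      by (intro tendsto_sum summable_LIMSEQ summ) auto
  qed (use partial in blast)
  finally show ?thesis unfolding R_def p_def .
qed

lemma rcnorm_nonneg:
  assumes "\<forall>i<m. xs i \<in> S_set"
  shows "0 \<le> rcnorm k m xs"
  unfolding rcnorm_gram[OF assms] using opnorm_nonneg[OF gram_in_S_set[OF assms]] by (simp add: le_max_iff_disj)

section \<open>The Grothendieck constant\<close>

definition Kn_set :: "nat \<Rightarrow> real set" where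
  "Kn_set n = {C. \<forall>u. cont_bilinear u \<longrightarrow> bdd_above (bform_set n u) \<longrightarrow>
       (\<forall>m xs ys. (\<forall>j<m. xs j \<in> S_set \<and> ys j \<in> S_set) \<longrightarrow>
          cmod (\<Sum>j<m. u (xs j) (ys j))
            \<le> C * bnorm n u * rcnorm (2*n+1) m xs * rcnorm (2*n+1) m ys)}"

lemma bform_setI:
  "x \<in> S_set \<Longrightarrow> y \<in> S_set \<Longrightarrow> opnorm n x \<le> 1 \<Longrightarrow> opnorm n y \<le> 1 \<Longrightarrow> cmod (u x y) \<in> bform_set n u"
  unfolding bform_set_def by blast

lemma bnorm_nonneg:
  assumes "bdd_above (bform_set n u)"
  shows "0 \<le> bnorm n u"
proof -
  let ?z = "\<lambda>\<xi> j. 0"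
  have "cmod (u ?z ?z) \<le> bnorm n u"
    unfolding bnorm_def
    by (intro cSup_upper bform_setI S_set_zero assms) (simp_all add: opnorm_zero)
  then show ?thesis using norm_ge_zero[of "u ?z ?z"] by linarith
qed

lemma bilinear_bound:
  assumes u: "cont_bilinear u" and bdd: "bdd_above (bform_set n u)"
    and x: "x \<in> S_set" and y: "y \<in> S_set"
  shows "cmod (u x y) \<le> bnorm n u * opnorm n x * opnorm n y"
proof -
  let ?p = "opnorm n x" and ?q = "opnorm n y"
  have p: "?p \<ge> 0" "?q \<ge> 0" using x y by (auto intro: opnorm_nonneg)
  \<comment> \<open>Normalising by the seminorm plus e avoids a division by zero; the claim follows
    as e tends to 0.\<close>
  have *: "cmod (u x y) \<le> bnorm n u * (?p + e) * (?q + e)" if e: "e > 0" for e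
  proof -
    define a where "a = 1 / (?p + e)"
    define b where "b = 1 / (?q + e)"
    have ab: "a > 0" "b > 0" using p e by (auto simp: a_def b_def)
    let ?x = "\<lambda>\<xi> j. complex_of_real a * x \<xi> j" and ?y = "\<lambda>\<xi> j. complex_of_real b * y \<xi> j"
    have S: "?x \<in> S_set" "?y \<in> S_set" by (intro S_set_scale x y)+
    have "a * ?p \<le> 1" "b * ?q \<le> 1" using p e by (auto simp: a_def b_def)
    then have "opnorm n ?x \<le> 1" "opnorm n ?y \<le> 1"
      using opnorm_scale[OF x, of n "complex_of_real a"] opnorm_scale[OF y, of n "complex_of_real b"] ab
      by (simp_all only: norm_of_real abs_of_pos)
    then have "cmod (u ?x ?y) \<le> bnorm n u"
      unfolding bnorm_def by (intro cSup_upper bdd bform_setI S)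
    moreover have "u ?x ?y = complex_of_real a * (complex_of_real b * u x y)"
      using u x y S unfolding cont_bilinear_def by simp
    ultimately have "a * b * cmod (u x y) \<le> bnorm n u"
      using ab by (simp add: norm_mult)
    then have "a * b * cmod (u x y) * ((?p + e) * (?q + e)) \<le> bnorm n u * ((?p + e) * (?q + e))"
      using p e by (intro mult_right_mono) auto
    moreover have "a * b * cmod (u x y) * ((?p + e) * (?q + e)) = cmod (u x y)"
      using p e by (simp add: a_def b_def)
    ultimately show ?thesis by (simp only: mult.assoc)
  qed
  have "((\<lambda>e. bnorm n u * (?p + e) * (?q + e)) \<longlongrightarrow> bnorm n u * (?p + 0) * (?q + 0)) (at_right 0)"
    by (intro tendsto_intros)
  then have "cmod (u x y) \<le> bnorm n u * (?p + 0) * (?q + 0)"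
    by (rule tendsto_lowerbound) (auto intro!: * eventually_at_rightI[of 0 1])
  then show ?thesis by simp
qed

text \<open>The form is bounded term by term by products of seminorms, and Cauchy--Schwarz in j
  separates the two families. Each family contributes a factor \<open>sqrt zeta2\<close> from the
  Hilbert--Schmidt estimate.\<close>

lemma zeta2_in_Kn_set: "zeta2 \<in> Kn_set n"
  unfolding Kn_set_def
proof (intro CollectI allI impI)
  fix u and m :: nat and xs ys
  assume u: "cont_bilinear u" and bdd: "bdd_above (bform_set n u)"
    and *: "\<forall>j<m. xs j \<in> S_set \<and> ys j \<in> S_set"
  define B where "B = bnorm n u"
  have B: "B \<ge> 0" unfolding B_def by (rule bnorm_nonneg[OF bdd])
  have xs: "\<forall>j<m. xs j \<in> S_set" and ys: "\<forall>j<m. ys j \<in> S_set" using * by auto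
  have L2: "L2_set (\<lambda>j. opnorm n (zs j)) {..<m} \<le> sqrt zeta2 * rcnorm (2*n+1) m zs"
    if zs: "\<forall>j<m. zs j \<in> S_set" for zs
  proof -
    have "L2_set (\<lambda>j. opnorm n (zs j)) {..<m} \<le> sqrt (zeta2 * (rcnorm (2*n+1) m zs)\<^sup>2)"
      unfolding L2_set_def by (intro real_sqrt_le_mono sum_opnorm_power2_le zs)
    then show ?thesis using rcnorm_nonneg[OF zs] by (simp add: real_sqrt_mult)
  qed
  have "cmod (\<Sum>j<m. u (xs j) (ys j)) \<le> (\<Sum>j<m. cmod (u (xs j) (ys j)))" by (rule norm_sum)
  also have "\<dots> \<le> (\<Sum>j<m. B * (\<bar>opnorm n (xs j)\<bar> * \<bar>opnorm n (ys j)\<bar>))"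
  proof (rule sum_mono)
    fix j assume "j \<in> {..<m}"
    then have j: "xs j \<in> S_set" "ys j \<in> S_set" using * by auto
    show "cmod (u (xs j) (ys j)) \<le> B * (\<bar>opnorm n (xs j)\<bar> * \<bar>opnorm n (ys j)\<bar>)"
      using bilinear_bound[OF u bdd j] opnorm_nonneg[OF j(1), of n] opnorm_nonneg[OF j(2), of n]
      by (simp add: B_def mult.assoc)
  qed
  also have "\<dots> \<le> B * (L2_set (\<lambda>j. opnorm n (xs j)) {..<m} * L2_set (\<lambda>j. opnorm n (ys j)) {..<m})"
    unfolding sum_distrib_left[symmetric] by (intro mult_left_mono L2_set_mult_ineq B)
  also have "\<dots> \<le> B * ((sqrt zeta2 * rcnorm (2*n+1) m xs) * (sqrt zeta2 * rcnorm (2*n+1) m ys))"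
    by (intro mult_left_mono mult_mono L2 xs ys B) (auto simp: zeta2_nonneg rcnorm_nonneg[OF xs])
  also have "\<dots> = (sqrt zeta2 * sqrt zeta2) * B * rcnorm (2*n+1) m xs * rcnorm (2*n+1) m ys"
    by (simp only: mult_ac)
  also have "sqrt zeta2 * sqrt zeta2 = zeta2" using zeta2_nonneg by simp
  finally show "cmod (\<Sum>j<m. u (xs j) (ys j))
      \<le> zeta2 * bnorm n u * rcnorm (2*n+1) m xs * rcnorm (2*n+1) m ys" by (simp add: B_def)
qed

lemma Kn_setD:
  assumes "C \<in> Kn_set n" "cont_bilinear u" "bdd_above (bform_set n u)"
    "\<forall>j<m. xs j \<in> S_set" "\<forall>j<m. ys j \<in> S_set"
  shows "cmod (\<Sum>j<m. u (xs j) (ys j)) \<le> C * (bnorm n u * rcnorm (2*n+1) m xs * rcnorm (2*n+1) m ys)"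
  using assms unfolding Kn_set_def by (simp add: mult.assoc)

lemma Kn_setI:
  assumes "\<And>u m xs ys. cont_bilinear u \<Longrightarrow> bdd_above (bform_set n u) \<Longrightarrow>
    \<forall>j<m. xs j \<in> S_set \<Longrightarrow> \<forall>j<m. ys j \<in> S_set \<Longrightarrow>
    cmod (\<Sum>j<m. u (xs j) (ys j)) \<le> C * (bnorm n u * rcnorm (2*n+1) m xs * rcnorm (2*n+1) m ys)"
  shows "C \<in> Kn_set n"
  using assms unfolding Kn_set_def by (simp add: mult.assoc)

lemma Grothendieck_factor_nonneg:
  assumes "bdd_above (bform_set n u)" "\<forall>j<m. xs j \<in> S_set" "\<forall>j<m. ys j \<in> S_set"
  shows "0 \<le> bnorm n u * rcnorm p m xs * rcnorm p m ys"
  by (intro mult_nonneg_nonneg bnorm_nonneg rcnorm_nonneg assms)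

lemma Kn_set_upward:
  assumes "C \<in> Kn_set n" "C \<le> D"
  shows "D \<in> Kn_set n"
proof (rule Kn_setI)
  fix u and m :: nat and xs ys
  assume *: "cont_bilinear u" "bdd_above (bform_set n u)" "\<forall>j<m. xs j \<in> S_set" "\<forall>j<m. ys j \<in> S_set"
  show "cmod (\<Sum>j<m. u (xs j) (ys j)) \<le> D * (bnorm n u * rcnorm (2*n+1) m xs * rcnorm (2*n+1) m ys)"
    by (rule order_trans[OF Kn_setD[OF assms(1) *]
          mult_right_mono[OF assms(2) Grothendieck_factor_nonneg[OF *(2-4)]]])
qed

lemma Kn_eq: "Kn n = Inf (Kn_set n)"
  by (simp add: Kn_def Kn_set_def)

text \<open>Covers the junk value \<open>Inf UNIV\<close>, so that no nonzero bilinear form has to be exhibited.\<close>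

lemma Kn_set_unbounded:
  assumes "\<not> bdd_below (Kn_set n)"
  shows "Kn_set n = UNIV"
proof -
  have "D \<in> Kn_set n" for D
  proof -
    obtain C where "C \<in> Kn_set n" "C \<le> D"
      using assms unfolding bdd_below_def by (meson linear)
    then show ?thesis by (rule Kn_set_upward)
  qed
  then show ?thesis by blast
qed

text \<open>The infimum is attained: for fixed data the inequality is a closed condition on the
  constant. If the admissible constants are unbounded below, every real is admissible, in particular
  whatever value \<open>Inf\<close> returns.\<close>

lemma Kn_in_Kn_set: "Kn n \<in> Kn_set n"
proof (cases "bdd_below (Kn_set n)")
  case True
  show ?thesis
  proof (rule Kn_setI)
    fix u and m :: nat and xs ys
    assume *: "cont_bilinear u" "bdd_above (bform_set n u)" "\<forall>j<m. xs j \<in> S_set" "\<forall>j<m. ys j \<in> S_set"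
    define F where "F = bnorm n u * rcnorm (2*n+1) m xs * rcnorm (2*n+1) m ys"
    define s where "s = cmod (\<Sum>j<m. u (xs j) (ys j))"
    have F: "F \<ge> 0" unfolding F_def by (rule Grothendieck_factor_nonneg[OF *(2-4)])
    have le: "s \<le> C * F" if "C \<in> Kn_set n" for C
      unfolding F_def s_def by (rule Kn_setD[OF that *])
    \<comment> \<open>For \<open>F = 0\<close> there is no quotient to compare with; the existence
      of one admissible constant already forces \<open>s = 0\<close>.\<close>
    have "s \<le> Kn n * F"
    proof (cases "F = 0")
      case True
      then show ?thesis using le[OF zeta2_in_Kn_set] by simp
    next
      case False
      then have "s / F \<le> Kn n"
        unfolding Kn_eq using F le zeta2_in_Kn_set[of n]
        by (intro cInf_greatest) (auto simp: divide_le_eq)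
      then show ?thesis using F False by (simp add: divide_le_eq)
    qed
    then show "cmod (\<Sum>j<m. u (xs j) (ys j)) \<le> Kn n * (bnorm n u * rcnorm (2*n+1) m xs * rcnorm (2*n+1) m ys)"
      unfolding F_def s_def .
  qed
next
  case False
  show ?thesis unfolding Kn_set_unbounded[OF False] by (rule UNIV_I)
qed

text \<open>A bound independent of n is what makes the supremum \<open>Kconst\<close> meaningful.
  The term \<open>Inf UNIV\<close> is one fixed unspecified real, which covers the degenerate case
  without knowing its value.\<close>

lemma Kn_le: "Kn n \<le> max zeta2 (Inf UNIV)"
proof (cases "bdd_below (Kn_set n)")
  case True
  then show ?thesis unfolding Kn_eq by (intro max.coboundedI1 cInf_lower zeta2_in_Kn_set)
next
  case False
  show ?thesis unfolding Kn_eq Kn_set_unbounded[OF False] by (rule max.cobounded2)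
qed

lemma Grothendieck_Kconst:
  assumes "n \<ge> 1" "cont_bilinear u" "bdd_above (bform_set n u)"
    "\<forall>j<m. xs j \<in> S_set" "\<forall>j<m. ys j \<in> S_set"
  shows "cmod (\<Sum>j<m. u (xs j) (ys j))
     \<le> Kconst * (bnorm n u * rcnorm (2*n+1) m xs * rcnorm (2*n+1) m ys)"
proof -
  have "bdd_above (Kn ` {1..})" by (rule bdd_aboveI2[OF Kn_le])
  with assms(1) have "Kn n \<le> Kconst" unfolding Kconst_def by (intro cSUP_upper) auto
  show ?thesis by (rule Kn_setD[OF Kn_set_upward[OF Kn_in_Kn_set \<open>Kn n \<le> Kconst\<close>] assms(2-5)])
qed

section \<open>States\<close>

text \<open>A dimension-free separation theorem: if the infimum of the squared distance of \<open>f\<close> to the nonnegative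
  orthant were positive, a short step towards the point \<open>b\<close> supplied by \<open>hyp\<close> for the
  current violations would undercut it.\<close>

lemma convex_alternative:
  fixes f :: "nat \<Rightarrow> 'a \<Rightarrow> real"
  assumes K: "K \<noteq> {}"
    and mix: "\<And>a b t. a \<in> K \<Longrightarrow> b \<in> E \<Longrightarrow> 0 \<le> t \<Longrightarrow> t \<le> 1 \<Longrightarrow>
       \<exists>c\<in>K. \<forall>i<m. f i c = (1 - t) * f i a + t * f i b"
    and B: "\<And>b. b \<in> E \<Longrightarrow> (\<Sum>i<m. (f i b)\<^sup>2) \<le> B"
    and hyp: "\<And>l \<delta>. (\<And>i. i < m \<Longrightarrow> 0 \<le> l i) \<Longrightarrow> 0 < \<delta> \<Longrightarrow> \<exists>b\<in>E. - \<delta> \<le> (\<Sum>i<m. l i * f i b)"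
    and e: "0 < e"
  shows "\<exists>a\<in>K. \<forall>i<m. - e \<le> f i a"
proof -
  define r where "r i a = max 0 (- f i a)" for i a
  define g where "g a = (\<Sum>i<m. (r i a)\<^sup>2)" for a
  define M where "M = Inf (g ` K)"
  have g0: "0 \<le> g a" for a unfolding g_def by (rule sum_nonneg) simp
  have bdd: "bdd_below (g ` K)" using g0 by (auto simp: bdd_below_def)
  have M_le: "M \<le> g a" if "a \<in> K" for a unfolding M_def using that bdd by (simp add: cINF_lower)
  have near: "\<exists>a\<in>K. g a < M + \<eta>" if "\<eta> > 0" for \<eta>
    using that cInf_lessD[of "g ` K" "M + \<eta>"] K unfolding M_def by auto
  have "M = 0"
  proof (rule ccontr)
    assume "M \<noteq> 0"
    moreover have "0 \<le> M" unfolding M_def using K g0 by (intro cINF_greatest) auto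
    ultimately have M: "M > 0" by simp
    \<comment> \<open>Zero weights turn \<open>hyp\<close> into the statement that \<open>E\<close>
      is nonempty, whence \<open>B\<close> is nonnegative.\<close>
    obtain b0 where "b0 \<in> E" using hyp[of "\<lambda>_. 0" 1] by auto
    then have B0: "B \<ge> 0" using B[of b0] by (meson order_trans sum_nonneg zero_le_power2)
    \<comment> \<open>A step of length t gains \<open>2 * t * g a\<close> to first order and loses
      \<open>t\<^sup>2 * (g a + B)\<close> to second order. Since \<open>g a < M + 1\<close>, this t
      keeps the loss below \<open>t * M\<close>.\<close>
    define t where "t = M / (M + 1 + B)"
    have t: "0 < t" "t < 1" using M B0 by (auto simp: t_def)
    have tB: "t * (M + 1 + B) = M" using M B0 by (simp add: t_def)
    \<comment> \<open>Within 1 of the infimum for the choice of t, and within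
      \<open>t * M / 2\<close>, the net decrease that the step will achieve.\<close>
    obtain a where a: "a \<in> K" "g a < M + min 1 (t * M / 2)"
      using near[of "min 1 (t * M / 2)"] t M by auto
    \<comment> \<open>The weights are the current violations. The tolerance \<open>M / 4\<close>
      costs at most \<open>t * M / 2\<close>, which the remaining first-order gain absorbs.\<close>
    obtain b where b: "b \<in> E" "- (M / 4) \<le> (\<Sum>i<m. r i a * f i b)"
      using hyp[of "\<lambda>i. r i a" "M / 4"] M by (auto simp: r_def)
    obtain c where c: "c \<in> K" "\<And>i. i < m \<Longrightarrow> f i c = (1 - t) * f i a + t * f i b"
      using mix[OF a(1) b(1), of t] t by auto
    have "(r i c)\<^sup>2 \<le> (1 - t)\<^sup>2 * (r i a)\<^sup>2 - 2 * t * (1 - t) * (r i a * f i b) + t\<^sup>2 * (f i b)\<^sup>2"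
      if "i < m" for i
    proof -
      have "(1 - t) * (- f i a) \<le> (1 - t) * r i a"
        using t by (intro mult_left_mono) (auto simp: r_def)
      then have "r i c \<le> \<bar>(1 - t) * r i a - t * f i b\<bar>"
        using c(2)[OF that] unfolding r_def by auto
      then have "(r i c)\<^sup>2 \<le> \<bar>(1 - t) * r i a - t * f i b\<bar>\<^sup>2"
        by (rule power_mono) (simp add: r_def)
      also have "\<dots> = (1 - t)\<^sup>2 * (r i a)\<^sup>2 - 2 * t * (1 - t) * (r i a * f i b) + t\<^sup>2 * (f i b)\<^sup>2"
        by (simp add: power2_eq_square algebra_simps)
      finally show ?thesis .
    qed
    then have "g c \<le> (\<Sum>i<m. (1 - t)\<^sup>2 * (r i a)\<^sup>2 - 2 * t * (1 - t) * (r i a * f i b) + t\<^sup>2 * (f i b)\<^sup>2)"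
      unfolding g_def by (intro sum_mono) auto
    also have "\<dots> = (1 - t)\<^sup>2 * g a - 2 * t * (1 - t) * (\<Sum>i<m. r i a * f i b) + t\<^sup>2 * (\<Sum>i<m. (f i b)\<^sup>2)"
      unfolding g_def sum.distrib sum_subtractf sum_distrib_left ..
    also have "\<dots> \<le> (1 - t)\<^sup>2 * g a + 2 * t * (1 - t) * (M / 4) + t\<^sup>2 * B"
    proof -
      have "2 * t * (1 - t) * (- (M / 4)) \<le> 2 * t * (1 - t) * (\<Sum>i<m. r i a * f i b)"
        using t by (intro mult_left_mono b) auto
      moreover have "t\<^sup>2 * (\<Sum>i<m. (f i b)\<^sup>2) \<le> t\<^sup>2 * B" by (intro mult_left_mono B b) simp
      ultimately show ?thesis by linarith
    qed
    also have "\<dots> \<le> g a - t * M / 2"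
    proof -
      have "t * (g a + B) \<le> t * (M + 1 + B)" using a t by (intro mult_left_mono) auto
      then have 1: "t * (t * (g a + B)) \<le> t * M" using t tB by (intro mult_left_mono) auto
      have 2: "t * M \<le> t * g a" using M_le[OF a(1)] t by (intro mult_left_mono) auto
      have 3: "t * t * M \<ge> 0" using t M by simp
      have "(1 - t)\<^sup>2 * g a + 2 * t * (1 - t) * (M / 4) + t\<^sup>2 * B
          = g a - 2 * (t * g a) + t * (t * (g a + B)) + t * M / 2 - t * t * M / 2"
        by (simp add: power2_eq_square algebra_simps)
      then show ?thesis using 1 2 3 by linarith
    qed
    also have "\<dots> < M" using a(2) by linarith
    finally show False using M_le[OF c(1)] by simp
  qed
  then obtain a where a: "a \<in> K" "g a < e\<^sup>2" using near[of "e\<^sup>2"] e by auto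
  have "- e \<le> f i a" if "i < m" for i
  proof -
    have "(r i a)\<^sup>2 \<le> g a"
      unfolding g_def using that by (intro member_le_sum[where f = "\<lambda>i. (r i a)\<^sup>2"]) auto
    with a(2) have "(r i a)\<^sup>2 < e\<^sup>2" by linarith
    then have "r i a < e" by (rule power2_less_imp_less) (use e in simp)
    then show ?thesis by (simp add: r_def)
  qed
  then show ?thesis using a by blast
qed

section \<open>Vector states and their convex combinations\<close>

lemma phi_bound:
  assumes "x \<in> S_set" "\<xi> \<in> s'ball n"
  shows "cmod (phi \<xi> x) \<le> opnorm n x"
proof -
  have "cmod (phi \<xi> x) \<le> snorm n (x \<xi>) * s'norm n \<xi>"
    unfolding phi_def using assms by (intro pair_bound S_set_in_s) (auto simp: s'ball_def)
  also have "\<dots> \<le> snorm n (x \<xi>) * 1"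
    using assms by (intro mult_left_mono snorm_nonneg S_set_in_s) (auto simp: s'ball_def)
  finally show ?thesis using snorm_le_opnorm[OF assms] by simp
qed

lemma conv_states_bound:
  assumes "\<psi> \<in> conv_states n" and x: "x \<in> S_set"
  shows "cmod (\<psi> x) \<le> opnorm n x"
proof -
  obtain m :: nat and c \<xi>s where c: "\<forall>i<m. c i \<ge> 0 \<and> \<xi>s i \<in> s'ball n" and c1: "(\<Sum>i<m. c i) = (1::real)"
    and \<psi>: "\<psi> = (\<lambda>x. \<Sum>i<m. complex_of_real (c i) * phi (\<xi>s i) x)"
    using assms(1) unfolding conv_states_def by (elim CollectE exE conjE)
  have "cmod (\<psi> x) \<le> (\<Sum>i<m. cmod (complex_of_real (c i) * phi (\<xi>s i) x))"
    unfolding \<psi> by (rule norm_sum)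
  also have "\<dots> \<le> (\<Sum>i<m. c i * opnorm n x)"
    by (rule sum_mono) (use c in \<open>auto simp: norm_mult intro!: mult_left_mono phi_bound x\<close>)
  finally show ?thesis using c1 by (simp add: sum_distrib_right[symmetric])
qed

lemma conv_states_linear:
  assumes "\<psi> \<in> conv_states n" and x: "x \<in> S_set" and y: "y \<in> S_set"
  shows "\<psi> (\<lambda>\<xi> j. x \<xi> j + y \<xi> j) = \<psi> x + \<psi> y" "\<psi> (\<lambda>\<xi> j. a * x \<xi> j) = a * \<psi> x"
proof -
  obtain m :: nat and c \<xi>s where c: "\<forall>i<m. c i \<ge> 0 \<and> \<xi>s i \<in> s'ball n" and c1: "(\<Sum>i<m. c i) = (1::real)"
    and \<psi>: "\<psi> = (\<lambda>x. \<Sum>i<m. complex_of_real (c i) * phi (\<xi>s i) x)"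
    using assms(1) unfolding conv_states_def by (elim CollectE exE conjE)
  have "phi (\<xi>s i) (\<lambda>\<xi> j. x \<xi> j + y \<xi> j) = phi (\<xi>s i) x + phi (\<xi>s i) y"
    "phi (\<xi>s i) (\<lambda>\<xi> j. a * x \<xi> j) = a * phi (\<xi>s i) x" if "i < m" for i
    unfolding phi_def using s'ball_in_s'_set[of "\<xi>s i" n] c that
    by (simp_all add: pair_add_left pair_scale_left S_set_in_s x y)
  then show "\<psi> (\<lambda>\<xi> j. x \<xi> j + y \<xi> j) = \<psi> x + \<psi> y" "\<psi> (\<lambda>\<xi> j. a * x \<xi> j) = a * \<psi> x"
    unfolding \<psi> by (simp_all add: sum.distrib[symmetric] distrib_left sum_distrib_left mult_ac)
qed

text \<open>The separation theorem moves only towards generators, so mixing with a single vector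
  state is the convexity it asks for.\<close>

lemma conv_states_mix:
  assumes "\<psi> \<in> conv_states n" and \<xi>: "\<xi> \<in> s'ball n" and t: "0 \<le> t" "t \<le> 1"
  shows "(\<lambda>x. complex_of_real (1 - t) * \<psi> x + complex_of_real t * phi \<xi> x) \<in> conv_states n"
proof -
  obtain m :: nat and c \<xi>s where c: "\<forall>i<m. c i \<ge> 0 \<and> \<xi>s i \<in> s'ball n" and c1: "(\<Sum>i<m. c i) = (1::real)"
    and \<psi>: "\<psi> = (\<lambda>x. \<Sum>i<m. complex_of_real (c i) * phi (\<xi>s i) x)"
    using assms(1) unfolding conv_states_def by (elim CollectE exE conjE)
  define c' where "c' i = (if i < m then (1 - t) * c i else t)" for i
  define \<xi>s' where "\<xi>s' i = (if i < m then \<xi>s i else \<xi>)" for i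
  have "\<forall>i<Suc m. c' i \<ge> 0 \<and> \<xi>s' i \<in> s'ball n"
    using c t \<xi> by (auto simp: c'_def \<xi>s'_def)
  moreover have "(\<Sum>i<Suc m. c' i) = 1"
    using c1 by (simp add: c'_def sum_distrib_left[symmetric])
  moreover have "(\<lambda>x. complex_of_real (1 - t) * \<psi> x + complex_of_real t * phi \<xi> x)
     = (\<lambda>x. \<Sum>i<Suc m. complex_of_real (c' i) * phi (\<xi>s' i) x)"
    by (rule ext) (simp add: \<psi> c'_def \<xi>s'_def sum_distrib_left mult.assoc)
  ultimately show ?thesis unfolding conv_states_def by blast
qed

lemma phi_in_conv_states:
  assumes "\<xi> \<in> s'ball n"
  shows "phi \<xi> \<in> conv_states n"
  unfolding conv_states_def
  by (intro CollectI exI[of _ "1::nat"] exI[of _ "\<lambda>_. 1"] exI[of _ "\<lambda>_. \<xi>"]) (use assms in auto)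

lemma phi_zero: "phi (\<lambda>j. 0) = (\<lambda>x. 0)"
  by (rule ext) (simp add: phi_def pair_def)

text \<open>States are not normalised here: the ball contains the zero vector, whose vector state is
  the zero functional. This supplies the witness in the degenerate cases.\<close>

lemma nstate_zero: "nstate n (\<lambda>x. 0)"
proof -
  have "(\<lambda>x. 0) \<in> conv_states n" using phi_in_conv_states[OF zero_in_s'ball, of n] by (simp add: phi_zero)
  then show ?thesis unfolding nstate_def S_dual_def by (auto intro!: exI[of _ 0] bexI)
qed

lemma rcnorm_power2_le:
  assumes xs: "\<forall>i<m. xs i \<in> S_set"
    and "\<And>\<xi>. \<xi> \<in> s'ball p \<Longrightarrow> (\<Sum>i<m. (snorm 0 (xs i \<xi>))\<^sup>2) \<le> M"
    and "\<And>\<xi>. \<xi> \<in> s'ball p \<Longrightarrow> (\<Sum>i<m. (snorm 0 (adj (xs i) \<xi>))\<^sup>2) \<le> M"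
  shows "(rcnorm p m xs)\<^sup>2 \<le> M"
proof -
  have "opnorm p (gram m xs) \<le> M" by (rule opnorm_gram_le[OF xs assms(2)])
  moreover have *: "\<forall>i<m. adj (xs i) \<in> S_set" using xs by (auto intro: S_set_adj)
  have "opnorm p (gram m (\<lambda>i. adj (xs i))) \<le> M" by (rule opnorm_gram_le[OF * assms(3)])
  moreover have "0 \<le> opnorm p (gram m xs)" by (intro opnorm_nonneg gram_in_S_set xs)
  ultimately have "0 \<le> M" "rcnorm p m xs \<le> sqrt M" unfolding rcnorm_gram[OF xs] by auto
  then show ?thesis using power_mono[OF _ rcnorm_nonneg[OF xs], of p "sqrt M" 2] by simp
qed

text \<open>The minimax step. If no pair of convex combinations worked up to e, some nonnegative
  weights would make the weighted inequality fail at all vector states by a fixed margin.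
  Homogeneity of q moves the weights into the operators, and the resulting family violates
  \<open>dom\<close>.\<close>

lemma approximating_states:
  fixes q :: "op \<Rightarrow> real" and m :: nat
  assumes C: "0 < C"
    and scale: "\<And>x c. x \<in> S_set \<Longrightarrow> q (\<lambda>\<xi> j. complex_of_real c * x \<xi> j) = c\<^sup>2 * q x"
    and dom: "\<And>(m::nat) xs. \<forall>i<m. xs i \<in> S_set \<Longrightarrow> (\<Sum>i<m. q (xs i)) \<le> C * (rcnorm p m xs)\<^sup>2"
    and xs: "\<forall>i<m. xs i \<in> S_set" and e: "0 < e"
  shows "\<exists>\<psi>1\<in>conv_states p. \<exists>\<psi>2\<in>conv_states p. \<forall>i<m.
    q (xs i) \<le> C * Re (\<psi>1 (opmult (adj (xs i)) (xs i)) + \<psi>2 (opmult (xs i) (adj (xs i)))) + e"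
proof -
  \<comment> \<open>The slack of the i-th inequality, an affine function of the pair of
    functionals.\<close>
  define f :: "nat \<Rightarrow> (op \<Rightarrow> complex) \<times> (op \<Rightarrow> complex) \<Rightarrow> real" where
    "f i z = C * Re (fst z (opmult (adj (xs i)) (xs i)) + snd z (opmult (xs i) (adj (xs i)))) - q (xs i)" for i z
  define E where "E = (\<lambda>(\<xi>, \<eta>). (phi \<xi>, phi \<eta>)) ` (s'ball p \<times> s'ball p)"
  define b where "b i = C * (opnorm p (opmult (adj (xs i)) (xs i)) + opnorm p (opmult (xs i) (adj (xs i)))) + \<bar>q (xs i)\<bar>" for i
  have f_phi: "f i (phi \<xi>, phi \<eta>) = C * ((snorm 0 (xs i \<xi>))\<^sup>2 + (snorm 0 (adj (xs i) \<eta>))\<^sup>2) - q (xs i)"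
    if "i < m" "\<xi> \<in> s'ball p" "\<eta> \<in> s'ball p" for i \<xi> \<eta>
    using that xs by (simp add: f_def phi_opmult_adj phi_opmult_adj_right s'ball_in_s'_set del: of_real_power)
  have "\<exists>z\<in>conv_states p \<times> conv_states p. \<forall>i<m. - e \<le> f i z"
  proof (rule convex_alternative[where E = E and B = "\<Sum>i<m. (b i)\<^sup>2"])
    show "conv_states p \<times> conv_states p \<noteq> {}" using phi_in_conv_states[OF zero_in_s'ball, of p] by blast
  next
    fix a z and t :: real assume a: "a \<in> conv_states p \<times> conv_states p" and z: "z \<in> E" and t: "0 \<le> t" "t \<le> 1"
    obtain \<xi> \<eta> where z': "z = (phi \<xi>, phi \<eta>)" and in_ball: "\<xi> \<in> s'ball p" "\<eta> \<in> s'ball p"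
      using z by (auto simp: E_def)
    let ?c = "(\<lambda>x. complex_of_real (1 - t) * fst a x + complex_of_real t * phi \<xi> x,
       \<lambda>x. complex_of_real (1 - t) * snd a x + complex_of_real t * phi \<eta> x)"
    have "?c \<in> conv_states p \<times> conv_states p" 
      using conv_states_mix[OF _ in_ball(1) t, of "fst a"] conv_states_mix[OF _ in_ball(2) t, of "snd a"] a
      by (simp add: mem_Times_iff)
    moreover have "f i ?c = (1 - t) * f i a + t * f i z" for i
      by (simp add: f_def z' algebra_simps)
    ultimately show "\<exists>c\<in>conv_states p \<times> conv_states p. \<forall>i<m. f i c = (1 - t) * f i a + t * f i z"
      by blast
  next
    fix z assume "z \<in> E"
    then obtain \<xi> \<eta> where z: "z = (phi \<xi>, phi \<eta>)" and in_ball: "\<xi> \<in> s'ball p" "\<eta> \<in> s'ball p"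
      by (auto simp: E_def)
    show "(\<Sum>i<m. (f i z)\<^sup>2) \<le> (\<Sum>i<m. (b i)\<^sup>2)"
    proof (rule sum_mono)
      fix i assume "i \<in> {..<m}"
      then have x: "xs i \<in> S_set" using xs by auto
      let ?A = "opmult (adj (xs i)) (xs i)" and ?B = "opmult (xs i) (adj (xs i))"
      have "\<bar>Re (phi \<xi> ?A)\<bar> \<le> opnorm p ?A" "\<bar>Re (phi \<eta> ?B)\<bar> \<le> opnorm p ?B"
        using phi_bound[OF S_set_opmult in_ball(1)] phi_bound[OF S_set_opmult in_ball(2)] x S_set_adj[OF x]
          abs_Re_le_cmod order_trans by blast+
      then have "\<bar>Re (phi \<xi> ?A + phi \<eta> ?B)\<bar> \<le> opnorm p ?A + opnorm p ?B" by simp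
      then have "\<bar>C * Re (phi \<xi> ?A + phi \<eta> ?B)\<bar> \<le> C * (opnorm p ?A + opnorm p ?B)"
        unfolding abs_mult using C by simp
      then have "\<bar>f i z\<bar> \<le> b i" unfolding f_def b_def z fst_conv snd_conv by linarith
      then show "(f i z)\<^sup>2 \<le> (b i)\<^sup>2" by (metis abs_ge_zero power2_abs power_mono)
    qed
  next
    fix l :: "nat \<Rightarrow> real" and \<delta> :: real assume l: "\<And>i. i < m \<Longrightarrow> 0 \<le> l i" and \<delta>: "0 < \<delta>"
    show "\<exists>z\<in>E. - \<delta> \<le> (\<Sum>i<m. l i * f i z)"
    proof (rule ccontr)
      assume "\<not> ?thesis"
      then have neg: "(\<Sum>i<m. l i * f i (phi \<xi>, phi \<eta>)) < - \<delta>"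
        if "\<xi> \<in> s'ball p" "\<eta> \<in> s'ball p" for \<xi> \<eta> using that by (force simp: E_def)
      \<comment> \<open>Scaling by the square root of the weight multiplies q and both squared norms
        by the weight itself.\<close>
      define ys where "ys i = (\<lambda>\<xi> j. complex_of_real (sqrt (l i)) * xs i \<xi> j)" for i
      have ys: "\<forall>i<m. ys i \<in> S_set" using xs by (auto simp: ys_def intro: S_set_scale)
      have q: "q (ys i) = l i * q (xs i)" if "i < m" for i
        using that xs l unfolding ys_def by (simp add: scale)
      have n1: "(snorm 0 (ys i \<xi>))\<^sup>2 = l i * (snorm 0 (xs i \<xi>))\<^sup>2" if "i < m" for i \<xi>
        using that xs l unfolding ys_def
        by (simp add: snorm_scale S_set_in_s power_mult_distrib)
      have n2: "(snorm 0 (adj (ys i) \<xi>))\<^sup>2 = l i * (snorm 0 (adj (xs i) \<xi>))\<^sup>2" if "i < m" for i \<xi>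
        using that xs l unfolding ys_def
        by (simp add: adj_scale snorm_scale S_set_in_s S_set_adj power_mult_distrib)
      define Q where "Q = (\<Sum>i<m. q (ys i))"
      have main: "C * ((\<Sum>i<m. (snorm 0 (ys i \<xi>))\<^sup>2) + (\<Sum>i<m. (snorm 0 (adj (ys i) \<eta>))\<^sup>2)) < Q - \<delta>"
        if "\<xi> \<in> s'ball p" "\<eta> \<in> s'ball p" for \<xi> \<eta>
      proof -
        have "(\<Sum>i<m. l i * f i (phi \<xi>, phi \<eta>))
            = (\<Sum>i<m. C * ((snorm 0 (ys i \<xi>))\<^sup>2 + (snorm 0 (adj (ys i) \<eta>))\<^sup>2) - q (ys i))"
          by (rule sum.cong) (auto simp: f_phi that q n1 n2 algebra_simps)
        also have "\<dots> = C * ((\<Sum>i<m. (snorm 0 (ys i \<xi>))\<^sup>2) + (\<Sum>i<m. (snorm 0 (adj (ys i) \<eta>))\<^sup>2)) - Q"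
          by (simp add: Q_def sum_subtractf sum_distrib_left[symmetric] sum.distrib)
        finally show ?thesis using neg[OF that] by linarith
      qed
      \<comment> \<open>The same vector is put in both slots and one of the two nonnegative sums is
        dropped. This bounds each half of the maximum in \<open>rcnorm\<close> separately.\<close>
      have "(rcnorm p m ys)\<^sup>2 \<le> (Q - \<delta>) / C"
      proof (rule rcnorm_power2_le[OF ys])
        fix \<xi> assume \<xi>: "\<xi> \<in> s'ball p"
        have "0 \<le> C * (\<Sum>i<m. (snorm 0 (ys i \<xi>))\<^sup>2)" "0 \<le> C * (\<Sum>i<m. (snorm 0 (adj (ys i) \<xi>))\<^sup>2)"
          using C by (auto intro!: mult_nonneg_nonneg sum_nonneg)
        then have "C * (\<Sum>i<m. (snorm 0 (ys i \<xi>))\<^sup>2) \<le> Q - \<delta>"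
          "C * (\<Sum>i<m. (snorm 0 (adj (ys i) \<xi>))\<^sup>2) \<le> Q - \<delta>"
          using main[OF \<xi> \<xi>] unfolding distrib_left by linarith+
        then show "(\<Sum>i<m. (snorm 0 (ys i \<xi>))\<^sup>2) \<le> (Q - \<delta>) / C"
          "(\<Sum>i<m. (snorm 0 (adj (ys i) \<xi>))\<^sup>2) \<le> (Q - \<delta>) / C"
          using C by (simp_all only: pos_le_divide_eq mult.commute[of C])
      qed
      then have "C * (rcnorm p m ys)\<^sup>2 \<le> Q - \<delta>" using C by (simp add: pos_le_divide_eq mult.commute)
      then show False using dom[OF ys] \<delta> unfolding Q_def by linarith
    qed
  qed (rule e)
  then obtain \<psi>1 \<psi>2 where "\<psi>1 \<in> conv_states p" "\<psi>2 \<in> conv_states p" "\<And>i. i < m \<Longrightarrow> - e \<le> f i (\<psi>1, \<psi>2)"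
    by auto
  then show ?thesis unfolding f_def by (intro bexI[of _ \<psi>1] bexI[of _ \<psi>2]) force+
qed

section \<open>Semi-inner products\<close>

lemma frechet_hilbertD:
  assumes "frechet_hilbert smul ip"
  shows "ip k (a + b) c = ip k a c + ip k b c" "ip k (smul r a) b = r * ip k a b"
    "ip k a b = cnj (ip k b a)" "0 \<le> Re (ip k a a)"
proof -
  from assms have 1: "\<forall>k a b c. ip k (a + b) c = ip k a c + ip k b c"
    and 2: "\<forall>k r a b. ip k (smul r a) b = r * ip k a b"
    and 3: "\<forall>k a b. ip k a b = cnj (ip k b a)" and 4: "\<forall>k a. Re (ip k a a) \<ge> 0"
    unfolding frechet_hilbert_def by - (elim conjE, assumption)+
  show "ip k (a + b) c = ip k a c + ip k b c" by (rule 1[rule_format])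
  show "ip k (smul r a) b = r * ip k a b" by (rule 2[rule_format])
  show "ip k a b = cnj (ip k b a)" by (rule 3[rule_format])
  show "0 \<le> Re (ip k a a)" by (rule 4[rule_format])
qed

lemma frechet_hilbert_right:
  assumes "frechet_hilbert smul ip"
  shows "ip k c (a + b) = ip k c a + ip k c b" "ip k a (smul r b) = cnj r * ip k a b"
proof -
  note fh = frechet_hilbertD[OF assms]
  have "ip k c (a + b) = cnj (ip k a c + ip k b c)" unfolding fh(1)[symmetric] by (rule fh(3))
  then show "ip k c (a + b) = ip k c a + ip k c b" unfolding complex_cnj_add fh(3)[symmetric] .
  have "ip k a (smul r b) = cnj (r * ip k b a)" unfolding fh(2)[symmetric] by (rule fh(3))
  then show "ip k a (smul r b) = cnj r * ip k a b" unfolding complex_cnj_mult fh(3)[symmetric] .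
qed

lemma semi_inner_Cauchy_Schwarz:
  assumes "frechet_hilbert smul ip"
  shows "cmod (ip k a b) \<le> hnorm ip k a * hnorm ip k b"
proof -
  have add: "ip k (a + b) c = ip k a c + ip k b c" for a b c
    by (rule frechet_hilbertD(1)[OF assms])
  have smul: "ip k (smul r a) b = r * ip k a b" for r a b
    by (rule frechet_hilbertD(2)[OF assms])
  have sym: "ip k a b = cnj (ip k b a)" for a b
    by (rule frechet_hilbertD(3)[OF assms])
  have pos: "0 \<le> Re (ip k a a)" for a
    by (rule frechet_hilbertD(4)[OF assms])
  have add': "ip k c (a + b) = ip k c a + ip k c b" for a b c
    by (rule frechet_hilbert_right(1)[OF assms])
  have smul': "ip k a (smul r b) = cnj r * ip k a b" for r a b
    by (rule frechet_hilbert_right(2)[OF assms])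
  define A B p where "A = Re (ip k a a)" and "B = Re (ip k b b)" and "p = ip k a b"
  have real: "ip k b b = complex_of_real B" unfolding B_def using sym[of b b]
    by (metis complex_is_Real_iff of_real_Re Reals_cnj_iff)
  \<comment> \<open>Positivity at \<open>a - t p b\<close>, where p is the semi-inner product of a
    and b; the phase of p makes the cross terms real.\<close>
  have key: "0 \<le> A - 2 * t * (cmod p)\<^sup>2 + t\<^sup>2 * (cmod p)\<^sup>2 * B" for t :: real
  proof -
    define r where "r = - complex_of_real t * p"
    have "ip k (a + smul r b) (a + smul r b) = ip k a a + cnj r * p + r * cnj p + r * cnj r * complex_of_real B"
      unfolding add add' smul smul' real[symmetric] p_def sym[of b a] by (simp add: algebra_simps)
    moreover have "cnj r * p + r * cnj p = complex_of_real (- 2 * t * (cmod p)\<^sup>2)"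
      unfolding r_def of_real_mult complex_norm_square by (simp add: mult_ac)
    moreover have "r * cnj r * complex_of_real B = complex_of_real (t\<^sup>2 * (cmod p)\<^sup>2 * B)"
      unfolding r_def of_real_mult complex_norm_square by (simp add: power2_eq_square mult_ac)
    ultimately have "ip k (a + smul r b) (a + smul r b)
        = ip k a a + complex_of_real (- 2 * t * (cmod p)\<^sup>2) + complex_of_real (t\<^sup>2 * (cmod p)\<^sup>2 * B)"
      by (simp only: add.assoc)
    then show ?thesis using pos[of "a + smul r b"] unfolding A_def by (simp del: of_real_mult of_real_power)
  qed
  have "(cmod p)\<^sup>2 \<le> A * B"
  proof (cases "B = 0")
    case True
    have "p = 0"
    proof (rule ccontr)
      assume "p \<noteq> 0"
      \<comment> \<open>A semi-inner product may vanish on nonzero b. At this t the inequality would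
        read \<open>0 \<le> A - (A + 1)\<close>.\<close>
      then show False using key[of "(A + 1) / (2 * (cmod p)\<^sup>2)"] True by simp
    qed
    then show ?thesis by (simp add: True)
  next
    case False
    then have "B > 0" using pos[of b] by (simp add: B_def)
    then have "0 \<le> A - (cmod p)\<^sup>2 / B" using key[of "1 / B"] by (simp add: power2_eq_square)
    then show ?thesis using \<open>B > 0\<close> by (simp add: field_simps)
  qed
  then have "cmod p \<le> sqrt (A * B)" by (rule real_le_rsqrt)
  then show ?thesis unfolding p_def A_def B_def hnorm_def by (simp add: real_sqrt_mult)
qed

lemma hnorm_smul:
  assumes "frechet_hilbert smul ip"
  shows "(hnorm ip k (smul r a))\<^sup>2 = (cmod r)\<^sup>2 * (hnorm ip k a)\<^sup>2"
proof -
  have smul: "ip k (smul r a) b = r * ip k a b" for r a b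
    by (rule frechet_hilbertD(2)[OF assms])
  have sym: "ip k a b = cnj (ip k b a)" for a b
    by (rule frechet_hilbertD(3)[OF assms])
  have pos: "0 \<le> Re (ip k a a)" for a
    by (rule frechet_hilbertD(4)[OF assms])
  have "ip k (smul r a) (smul r a) = r * cnj (ip k (smul r a) a)" using smul[of r a "smul r a"] sym[of a "smul r a"] by (simp only:)
  also have "\<dots> = (r * cnj r) * cnj (ip k a a)" by (simp add: smul)
  also have "\<dots> = complex_of_real ((cmod r)\<^sup>2) * cnj (ip k a a)" by (simp only: complex_norm_square)
  finally have "Re (ip k (smul r a) (smul r a)) = (cmod r)\<^sup>2 * Re (ip k a a)" by (simp del: of_real_power)
  then show ?thesis unfolding hnorm_def using pos by simp
qed

lemma hnorm_nonneg:
  assumes "frechet_hilbert smul ip"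
  shows "0 \<le> hnorm ip k h"
  unfolding hnorm_def using frechet_hilbertD(4)[OF assms] by simp

lemma ip_self:
  assumes "frechet_hilbert smul ip"
  shows "ip k h h = complex_of_real ((hnorm ip k h)\<^sup>2)"
proof -
  have sym: "ip k h h = cnj (ip k h h)" by (rule frechet_hilbertD(3)[OF assms])
  have pos: "0 \<le> Re (ip k h h)" by (rule frechet_hilbertD(4)[OF assms])
  from sym have "Im (ip k h h) = 0" by (metis Reals_cnj_iff complex_is_Real_iff)
  then show ?thesis unfolding hnorm_def using pos by (simp add: complex_eq_iff)
qed

section \<open>Weak-star compactness\<close>

definition S_restrict :: "(op \<Rightarrow> complex) \<Rightarrow> op \<Rightarrow> complex" where
  "S_restrict \<psi> = (\<lambda>x. if x \<in> S_set then \<psi> x else 0)"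

text \<open>Restricting to \<open>S_set\<close> keeps all coordinates bounded, as needed for compactness.\<close>

definition state_region :: "nat \<Rightarrow> (op \<Rightarrow> complex) set" where
  "state_region n = closure (S_restrict ` conv_states n)"

lemma compact_bounded_functionals:
  fixes D :: "op \<Rightarrow> real"
  shows "compact {(g :: op \<Rightarrow> complex). \<forall>x. cmod (g x) \<le> D x}"
proof -
  have "{(g :: op \<Rightarrow> complex). \<forall>x. cmod (g x) \<le> D x} = PiE UNIV (\<lambda>x. cball 0 (D x))"
    by (auto simp: PiE_def Pi_def)
  moreover have "compactin (product_topology (\<lambda>x::op. euclidean :: complex topology) UNIV) (PiE UNIV (\<lambda>x. cball 0 (D x)))"
    unfolding compactin_PiE by simp
  ultimately show ?thesis by (simp add: euclidean_product_topology)
qed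

section \<open>Passage to exact states\<close>

text \<open>Linearity and the seminorm bound are closed conditions on finitely many coordinates, so
  it is enough to check them on convex combinations of vector states.\<close>

lemma state_region_induct:
  assumes "\<phi> \<in> state_region n" "closed {g. P g}"
    "\<And>\<psi>. \<psi> \<in> conv_states n \<Longrightarrow> P (S_restrict \<psi>)"
  shows "P \<phi>"
proof -
  have "state_region n \<subseteq> {g. P g}"
    unfolding state_region_def using assms(2,3) by (intro closure_minimal) auto
  then show ?thesis using assms(1) by blast
qed

lemma continuous_on_eval: "continuous_on A (\<lambda>g :: op \<Rightarrow> complex. g x)"
  by (rule continuous_on_product_then_coordinatewise[OF continuous_on_id])

text \<open>The topology on functionals is that of pointwise convergence, so a point of the closure
  is approximated on every finite set of operators, as \<open>nstate\<close> demands. The common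
  bound by the seminorm of order n survives the limit and gives continuity.\<close>

lemma nstate_state_region:
  assumes \<phi>: "\<phi> \<in> state_region n"
  shows "nstate n \<phi>"
proof -
  have "\<phi> (\<lambda>\<xi> j. x \<xi> j + y \<xi> j) = \<phi> x + \<phi> y" if "x \<in> S_set" "y \<in> S_set" for x y
    by (rule state_region_induct[OF \<phi>])
      (use that in \<open>auto intro!: closed_Collect_eq continuous_intros continuous_on_eval
        simp: S_restrict_def S_set_add conv_states_linear(1)\<close>)
  moreover have "\<phi> (\<lambda>\<xi> j. c * x \<xi> j) = c * \<phi> x" if x: "x \<in> S_set" for x c
    by (rule state_region_induct[OF \<phi>])
      (use x in \<open>auto intro!: closed_Collect_eq continuous_intros continuous_on_eval
        simp: S_restrict_def S_set_scale conv_states_linear(2)[OF _ x x]\<close>)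
  moreover have "cmod (\<phi> x) \<le> 1 * opnorm n x" if x: "x \<in> S_set" for x
    by (rule state_region_induct[OF \<phi>])
      (use x in \<open>auto intro!: closed_Collect_le continuous_intros continuous_on_eval
        simp: S_restrict_def conv_states_bound\<close>)
  ultimately have "\<phi> \<in> S_dual" unfolding S_dual_def by blast
  moreover have "\<exists>\<psi>\<in>conv_states n. \<forall>x\<in>F. cmod (\<phi> x - \<psi> x) < \<epsilon>"
    if F: "finite F" "F \<subseteq> S_set" and \<epsilon>: "\<epsilon> > 0" for F \<epsilon>
  proof -
    define V where "V = (\<Inter>x\<in>F. {g. cmod (\<phi> x - g x) < \<epsilon>})"
    have "open V" unfolding V_def
      by (intro open_INT F ballI open_Collect_less continuous_intros continuous_on_eval)
    moreover have "\<phi> \<in> V" using \<epsilon> by (simp add: V_def)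
    ultimately have "V \<inter> S_restrict ` conv_states n \<noteq> {}"
      using \<phi> open_Int_closure_eq_empty[of V] unfolding state_region_def by blast
    then show ?thesis using F by (force simp: V_def S_restrict_def)
  qed
  ultimately show ?thesis unfolding nstate_def by blast
qed

text \<open>Banach--Alaoglu: the bound by the seminorm of order n confines the closed set to a
  product of discs.\<close>

lemma compact_state_region: "compact (state_region n)"
proof -
  define D where "D x = (if x \<in> S_set then opnorm n x else 0)" for x
  have "cmod (\<phi> x) \<le> D x" if "\<phi> \<in> state_region n" for \<phi> x
  proof (rule state_region_induct[OF that])
    show "closed {g :: op \<Rightarrow> complex. cmod (g x) \<le> D x}"
      by (intro closed_Collect_le continuous_intros continuous_on_eval)
  qed (simp add: S_restrict_def D_def conv_states_bound)
  then have "{g. \<forall>x. cmod (g x) \<le> D x} \<inter> state_region n = state_region n" by blast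
  moreover have "compact ({g. \<forall>x. cmod (g x) \<le> D x} \<inter> state_region n)"
    by (intro compact_Int_closed compact_bounded_functionals) (simp add: state_region_def)
  ultimately show ?thesis by (simp only:)
qed

text \<open>Each operator and each error define a closed condition on the pair of states. Finitely
  many of them hold jointly by the approximate version, so compactness satisfies all of them with
  one pair.\<close>

lemma exact_states:
  fixes q :: "op \<Rightarrow> real"
  assumes C: "0 < C"
    and scale: "\<And>x c. x \<in> S_set \<Longrightarrow> q (\<lambda>\<xi> j. complex_of_real c * x \<xi> j) = c\<^sup>2 * q x"
    and dom: "\<And>(m::nat) xs. \<forall>i<m. xs i \<in> S_set \<Longrightarrow> (\<Sum>i<m. q (xs i)) \<le> C * (rcnorm p m xs)\<^sup>2"
  shows "\<exists>\<phi>1 \<phi>2. nstate p \<phi>1 \<and> nstate p \<phi>2 \<and>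
    (\<forall>x\<in>S_set. q x \<le> C * Re (\<phi>1 (opmult (adj x) x) + \<phi>2 (opmult x (adj x))))"
proof -
  let ?R = "state_region p \<times> state_region p"
  define h where "h z x = C * Re (fst z (opmult (adj x) x) + snd z (opmult x (adj x)))"
    for z :: "(op \<Rightarrow> complex) \<times> (op \<Rightarrow> complex)" and x
  \<comment> \<open>The error belongs to the index, so a point of the full intersection satisfies
    the bound for every positive error and hence without error.\<close>
  define G where "G i = {z. q (fst i) \<le> h z (fst i) + snd i}" for i :: "op \<times> real"
  have "?R \<inter> \<Inter> (G ` (S_set \<times> {0<..})) \<noteq> {}"
  proof (rule compact_imp_fip_image)
    show "compact ?R" by (intro compact_Times compact_state_region)
    show "closed (G i)" for i
      unfolding G_def h_def
      by (intro closed_Collect_le continuous_intros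
          continuous_on_product_then_coordinatewise[OF continuous_on_fst[OF continuous_on_id]]
          continuous_on_product_then_coordinatewise[OF continuous_on_snd[OF continuous_on_id]])
    fix I :: "(op \<times> real) set" assume I: "finite I" "I \<subseteq> S_set \<times> {0<..}"
    \<comment> \<open>The smallest error occurring in \<open>I\<close>; the inserted 1 covers an
      empty \<open>I\<close>.\<close>
    define e where "e = Min (insert 1 (snd ` I))"
    have e: "e > 0" "\<And>i. i \<in> I \<Longrightarrow> e \<le> snd i" using I by (auto simp: e_def)
    obtain m :: nat and xs where xs: "fst ` I = xs ` {..<m}"
      using I(1) ex_bij_betw_nat_finite[of "fst ` I"] unfolding bij_betw_def lessThan_atLeast0
      by (metis finite_imageI)
    have S: "\<forall>i<m. xs i \<in> S_set" using I(2) xs by force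
    obtain \<psi>1 \<psi>2 where \<psi>: "\<psi>1 \<in> conv_states p" "\<psi>2 \<in> conv_states p"
      "\<forall>i<m. q (xs i) \<le> C * Re (\<psi>1 (opmult (adj (xs i)) (xs i)) + \<psi>2 (opmult (xs i) (adj (xs i)))) + e"
      using approximating_states[OF C scale dom S e(1)] by blast
    have "(S_restrict \<psi>1, S_restrict \<psi>2) \<in> ?R"
      unfolding state_region_def using \<psi> closure_subset by blast
    moreover have "(S_restrict \<psi>1, S_restrict \<psi>2) \<in> G i" if i: "i \<in> I" for i
    proof -
      obtain l where l: "l < m" "fst i = xs l" using i xs by blast
      then have "xs l \<in> S_set" using S by blast
      then have "h (S_restrict \<psi>1, S_restrict \<psi>2) (xs l)
          = C * Re (\<psi>1 (opmult (adj (xs l)) (xs l)) + \<psi>2 (opmult (xs l) (adj (xs l))))"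
        by (simp add: h_def S_restrict_def S_set_opmult S_set_adj)
      moreover have "q (xs l) \<le> C * Re (\<psi>1 (opmult (adj (xs l)) (xs l)) + \<psi>2 (opmult (xs l) (adj (xs l)))) + e"
        using \<psi>(3) l(1) by blast
      ultimately show ?thesis using e(2)[OF i] unfolding G_def mem_Collect_eq l(2) by linarith
    qed
    ultimately show "?R \<inter> \<Inter> (G ` I) \<noteq> {}" by blast
  qed
  then obtain z where z: "z \<in> ?R" "z \<in> \<Inter> (G ` (S_set \<times> {0<..}))" by blast
  have "q x \<le> h z x" if "x \<in> S_set" for x
  proof (rule field_le_epsilon)
    fix e :: real assume "0 < e"
    then have "(x, e) \<in> S_set \<times> {0<..}" using that by simp
    then have "z \<in> G (x, e)" using z(2) by blast
    then show "q x \<le> h z x + e" by (simp add: G_def)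
  qed
  then show ?thesis
    using z(1) unfolding h_def
    by (intro exI[of _ "fst z"] exI[of _ "snd z"]) (auto intro: nstate_state_region)
qed

section \<open>The bilinear form of u and the final estimate\<close>

lemma cont_lin_mapD:
  assumes "cont_lin_map smul ip u"
  shows "x \<in> S_set \<Longrightarrow> y \<in> S_set \<Longrightarrow> u (\<lambda>\<xi> j. x \<xi> j + y \<xi> j) = u x + u y"
    "x \<in> S_set \<Longrightarrow> u (\<lambda>\<xi> j. c * x \<xi> j) = smul c (u x)"
    "\<exists>n C. \<forall>x\<in>S_set. hnorm ip k (u x) \<le> C * opnorm n x"
  using assms unfolding cont_lin_map_def by blast+

text \<open>The conjugate linearity of \<open>adj\<close> cancels that of the second slot of the
  semi-inner product. Continuity survives because \<open>adj\<close> preserves every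
  seminorm.\<close>

lemma cont_bilinear_ip:
  assumes fh: "frechet_hilbert smul ip" and u: "cont_lin_map smul ip u"
  shows "cont_bilinear (\<lambda>x y. ip k (u x) (u (adj y)))"
proof -
  obtain n C where C: "\<And>x. x \<in> S_set \<Longrightarrow> hnorm ip k (u x) \<le> C * opnorm n x"
    using cont_lin_mapD(3)[OF u] by blast
  have "cmod (ip k (u x) (u (adj y))) \<le> C * C * opnorm n x * opnorm n y"
    if x: "x \<in> S_set" and y: "y \<in> S_set" for x y
  proof -
    have "cmod (ip k (u x) (u (adj y))) \<le> hnorm ip k (u x) * hnorm ip k (u (adj y))"
      by (rule semi_inner_Cauchy_Schwarz[OF fh])
    also have "\<dots> \<le> (C * opnorm n x) * (C * opnorm n (adj y))"
      using order_trans[OF hnorm_nonneg[OF fh] C[OF x]]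
      by (intro mult_mono C x S_set_adj y hnorm_nonneg[OF fh])
    finally show ?thesis by (simp add: opnorm_adj[OF y] mult_ac)
  qed
  then have "\<exists>n C. \<forall>x\<in>S_set. \<forall>y\<in>S_set. cmod (ip k (u x) (u (adj y))) \<le> C * opnorm n x * opnorm n y"
    by blast
  then show ?thesis
    unfolding cont_bilinear_def
    by (auto simp: cont_lin_mapD[OF u] adj_add adj_scale S_set_adj
        frechet_hilbertD(1,2)[OF fh] frechet_hilbert_right[OF fh])
qed

text \<open>Adjoints exchange the two terms of the maximum. Thus the two families in the
  Grothendieck inequality contribute equal factors and a square appears.\<close>

lemma rcnorm_adj:
  assumes xs: "\<forall>i<m. xs i \<in> S_set"
  shows "rcnorm k m (\<lambda>i. adj (xs i)) = rcnorm k m xs"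
proof -
  have "gram m (\<lambda>i. adj (adj (xs i))) = gram m xs"
    using xs by (simp add: gram_def opsum_def adj_adj cong: sum.cong_simp)
  then show ?thesis
    using rcnorm_gram[OF xs, of k] rcnorm_gram[of m "\<lambda>i. adj (xs i)" k] xs
    by (simp add: S_set_adj max.commute)
qed

theorem theorem4p3:
  fixes smul :: "complex \<Rightarrow> 'h::ab_group_add \<Rightarrow> 'h"
    and ip :: "nat \<Rightarrow> 'h \<Rightarrow> 'h \<Rightarrow> complex"
    and u :: "op \<Rightarrow> 'h" and k n :: nat
  assumes "frechet_hilbert smul ip" and "cont_lin_map smul ip u" and "k \<ge> 1" and "n \<ge> 1"
  shows "\<exists>\<phi>1 \<phi>2. nstate (2*n+1) \<phi>1 \<and> nstate (2*n+1) \<phi>2 \<and>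
     (bdd_above (unorm_set ip u n k) \<longrightarrow>
       (\<forall>x\<in>S_set. hnorm ip k (u x)
          \<le> sqrt Kconst * unorm ip u n k
             * sqrt (Re (\<phi>1 (opmult (adj x) x) + \<phi>2 (opmult x (adj x))))))"
proof (cases "bdd_above (unorm_set ip u n k)")
  \<comment> \<open>Here the norm of u is infinite, so the estimate is vacuous and any states will
    do.\<close>
  case False
  then show ?thesis
    by (intro exI[of _ "\<lambda>x. 0"] conjI impI nstate_zero) simp
next
  case True
  note fh = assms(1) and lin = assms(2)
  let ?p = "2*n+1"
  define U where "U = unorm ip u n k"
  define v where "v = (\<lambda>x y. ip k (u x) (u (adj y)))"
  define q where "q x = (hnorm ip k (u x))\<^sup>2" for x
  have u_le: "hnorm ip k (u x) \<le> U" if "x \<in> S_set" "opnorm n x \<le> 1" for x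
    unfolding U_def unorm_def using that by (intro cSup_upper True) (auto simp: unorm_set_def)
  have U: "0 \<le> U"
    by (rule order_trans[OF hnorm_nonneg[OF fh] u_le[OF S_set_zero]]) (simp add: opnorm_zero)
  have v: "cont_bilinear v" unfolding v_def by (rule cont_bilinear_ip[OF fh lin])
  have v_le: "b \<le> U\<^sup>2" if b: "b \<in> bform_set n v" for b
  proof -
    obtain x y where xy: "x \<in> S_set" "y \<in> S_set" "opnorm n x \<le> 1" "opnorm n y \<le> 1" and "b = cmod (v x y)"
      using b unfolding bform_set_def by blast
    then have "b \<le> hnorm ip k (u x) * hnorm ip k (u (adj y))"
      using semi_inner_Cauchy_Schwarz[OF fh] by (simp add: v_def)
    also have "\<dots> \<le> U * U"
      using xy by (intro mult_mono u_le hnorm_nonneg[OF fh] U) (auto simp: S_set_adj opnorm_adj)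
    finally show ?thesis by (simp add: power2_eq_square)
  qed
  have bdd: "bdd_above (bform_set n v)" using v_le by (auto simp: bdd_above_def)
  have bnorm_le: "bnorm n v \<le> U\<^sup>2"
    unfolding bnorm_def
    by (rule cSup_least)
      (use v_le bform_setI[OF S_set_zero S_set_zero, of n v] in \<open>auto simp: opnorm_zero\<close>)
  \<comment> \<open>The factor \<open>bnorm n v\<close> is kept for now: replacing it by
    \<open>U\<^sup>2\<close> is monotone only for nonnegative \<open>Kconst\<close>, a sign that is
    read off later from \<open>D > 0\<close>.\<close>
  define D where "D = Kconst * bnorm n v"
  have dom: "(\<Sum>i<m. q (xs i)) \<le> D * (rcnorm ?p m xs)\<^sup>2" if xs: "\<forall>i<m. xs i \<in> S_set" for m :: nat and xs
  proof -
    have "(\<Sum>i<m. v (xs i) (adj (xs i))) = complex_of_real (\<Sum>i<m. q (xs i))"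
      unfolding of_real_sum
      by (rule sum.cong) (use xs in \<open>auto simp: v_def q_def adj_adj ip_self[OF fh] simp del: of_real_power\<close>)
    then have "(\<Sum>i<m. q (xs i)) \<le> cmod (\<Sum>i<m. v (xs i) (adj (xs i)))"
      by (simp only: norm_of_real abs_ge_self)
    also have "\<dots> \<le> Kconst * (bnorm n v * rcnorm ?p m xs * rcnorm ?p m (\<lambda>i. adj (xs i)))"
      using Grothendieck_Kconst[OF assms(4) v bdd xs, of "\<lambda>i. adj (xs i)"] xs by (simp add: S_set_adj)
    also have "\<dots> = D * (rcnorm ?p m xs)\<^sup>2"
      unfolding rcnorm_adj[OF xs] D_def by (simp add: power2_eq_square mult_ac)
    finally show ?thesis .
  qed
  show ?thesis
  proof (cases "D \<le> 0")
    \<comment> \<open>The domination on one-element families makes the seminorm of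
      \<open>u x\<close> vanish for all x. With zero states the right-hand side is 0 whatever the
      sign of \<open>Kconst\<close>.\<close>
    case True
    have "hnorm ip k (u x) \<le> 0" if "x \<in> S_set" for x
    proof -
      have "q x \<le> D * (rcnorm ?p 1 (\<lambda>_. x))\<^sup>2" using dom[of 1 "\<lambda>_. x"] that by simp
      also have "\<dots> \<le> 0" using True by (simp add: mult_nonpos_nonneg)
      finally show ?thesis by (simp add: q_def)
    qed
    then show ?thesis
      by (intro exI[of _ "\<lambda>x. 0"] conjI impI nstate_zero) simp
  next
    case False
    then have D: "D > 0" by simp
    have K: "Kconst > 0"
      using D bnorm_nonneg[OF bdd] unfolding D_def by (simp add: zero_less_mult_iff)
    have scale: "q (\<lambda>\<xi> j. complex_of_real c * x \<xi> j) = c\<^sup>2 * q x" if "x \<in> S_set" for x c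
      using that by (simp add: q_def cont_lin_mapD(2)[OF lin] hnorm_smul[OF fh])
    obtain \<phi>1 \<phi>2 where \<phi>: "nstate ?p \<phi>1" "nstate ?p \<phi>2"
      "\<And>x. x \<in> S_set \<Longrightarrow> q x \<le> D * Re (\<phi>1 (opmult (adj x) x) + \<phi>2 (opmult x (adj x)))"
      using exact_states[of D q ?p, OF D scale dom] by blast
    have "hnorm ip k (u x) \<le> sqrt Kconst * U * sqrt (Re (\<phi>1 (opmult (adj x) x) + \<phi>2 (opmult x (adj x))))"
      if x: "x \<in> S_set" for x
    proof -
      let ?r = "Re (\<phi>1 (opmult (adj x) x) + \<phi>2 (opmult x (adj x)))"
      \<comment> \<open>Nonnegativity of the state values comes from the estimate itself, whose left
        side is a square.\<close>
      have "0 \<le> D * ?r" using \<phi>(3)[OF x] unfolding q_def by (meson order_trans zero_le_power2)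
      then have r: "0 \<le> ?r" using D by (simp add: zero_le_mult_iff)
      have "q x \<le> D * ?r" by (rule \<phi>(3)[OF x])
      also have "\<dots> \<le> (Kconst * U\<^sup>2) * ?r"
        unfolding D_def using K bnorm_le r by (intro mult_right_mono mult_left_mono) auto
      finally have "hnorm ip k (u x) \<le> sqrt ((Kconst * U\<^sup>2) * ?r)"
        unfolding q_def by (rule real_le_rsqrt)
      then show ?thesis using U by (simp only: real_sqrt_mult real_sqrt_abs abs_of_nonneg)
    qed
    then show ?thesis using \<phi>(1,2) unfolding U_def by blast
  qed
qed

end
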